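(* Let $(\psi(\tau_1,\tau_2))_{(\tau_1,\tau_2)\in\Theta\times\Theta}$ be a bi-admissible, $p$-integrable family. For $S\in\Theta$ set $$V(S)=\operatorname*{ess\,sup}_{(\tau_1,\tau_2)\in\Theta_S\times\Theta_S}\rho_{S,\tau_1\vee\tau_2}[\psi(\tau_1,\tau_2)],$$ and assume $V(S)\in L^p$ for each $S\in\Theta$. For $S\in\Theta$ define $$v_1(S)=\operatorname*{ess\,sup}_{\tau_1\in\Theta_S}\rho_{S,\tau_1}[\psi(\tau_1,S)],\qquad v_2(S)=\operatorname*{ess\,sup}_{\tau_2\in\Theta_S}\rho_{S,\tau_2}[\psi(S,\tau_2)],$$ $$\phi(S)=v_1(S)\vee v_2(S),\qquad u(S)=\operatorname*{ess\,sup}_{\tau\in\Theta_S}\rho_{S,\tau}[\phi(\tau)].$$ Let $S\in\Theta$ and assume that: i) $\theta^*\in\Theta_S$ is optimal for $u(S)$, i.e. $u(S)=\rho_{S,\theta^*}[\phi(\theta^* )]$; ii) $\theta_2^*\in\Theta_{\theta^*}$ is optimal for $v_2(\theta^* )$, i.e. $v_2(\theta^* )=\rho_{\theta^*,\theta_2^*}[\psi(\theta^*,\theta_2^* )]$; iii) $\theta_1^*\in\Theta_{\theta^*}$ is optimal for $v_1(\theta^* )$, i.e. $v_1(\theta^* )=\rho_{\theta^*,\theta_1^*}[\psi(\theta_1^*,\theta^* )]$. Let $B=\{v_1(\theta^* )\le v_2(\theta^* )\}$. Then the pair $(\tau_1^*,\tau_2^* )$ defined by $$\tau_1^*=\theta^*\mathbf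 1_B+\theta_1^*\mathbf 1_{B^c},\qquad \tau_2^*=\theta_2^*\mathbf 1_B+\theta^*\mathbf 1_{B^c}$$ is optimal for $V(S)$, i.e. $V(S)=\rho_{S,\tau_1^*\vee\tau_2^*}[\psi(\tau_1^*,\tau_2^* )]$.
   Context: Let $T>0$ be fixed and let $(\Omega,\mathcal F,P)$ be a complete probability space with a right-continuous complete filtration $(\mathcal F_t)_{t\in[0,T]}$. Equalities and inequalities between random variables, and equalities between measurable sets, are understood $P$-a.s. Let $(\theta_k)_{k\in\mathbb N}$ be a sequence of stopping times with $\theta_0=0$, $\theta_k\le\theta_{k+1}$ a.s. for all $k$, and $\lim_k\theta_k=T$ a.s. $\Theta$ (Bermudan stopping strategies) is the set of stopping times of the form $\tau=\sum_{k\ge0}\theta_k\mathbf 1_{A_k}+T\mathbf 1_{\bar A}$, where $\{(A_k)_{k\ge 0},\bar A\}$ is a partition of $\Omega$ with $A_k\in\mathcal F_{\theta_k}$ and $\bar A\in\mathcal F_T$. For $S\in\Theta$, $\Theta_S=\{\nu\in\Theta:\nu\ge S\text{ a.s.}\}$. Fix $p\in[1,+\infty]$. (In the claim, $\theta_1^*,\theta_2^*,\theta^*$ are elements of $\Theta$ unrelated to the sequence $(\theta_k)$.) A family $\xi=(\xi(\tau))_{\tau\in\Theta}$ of real random variables is admissible if $\xi(\tau)$ is $\mathcal F_\tau$-measurable and $\xi(\tau)=\xi(\tau')$ a.s. on $\{\tau=\tau'\}$ for all $\tau,\tau'\in\Theta$; it is $p$-integrable if each $\xi(\tau)\in L^p$.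 A family $(\psi(\tau_1,\tau_2))_{(\tau_1,\tau_2)\in\Theta\times\Theta}$ is bi-admissible if $\psi(\tau_1,\tau_2)$ is $\mathcal F_{\tau_1\vee\tau_2}$-measurable and $\psi(\tau_1,\tau_2)=\psi(\tilde\tau_1,\tilde\tau_2)$ on $\{\tau_1=\tilde\tau_1\}\cap\{\tau_2=\tilde\tau_2\}$; it is $p$-integrable if each $\psi(\tau_1,\tau_2)\in L^p$. The operators $\rho_{S,\tau}$, $S,\tau\in\Theta$, satisfy: (i) $\rho_{S,\tau}:L^p(\mathcal F_\tau)\to L^p(\mathcal F_S)$. (ii) (admissibility) $\rho_{S,\tau}[\eta]=\rho_{S',\tau}[\eta]$ a.s. on $\{S=S'\}$. (iii) (knowledge preservation) $\rho_{\tau,S}[\eta]=\eta$ for all $\eta\in L^p(\mathcal F_S)$, $\tau\in\Theta_S$. (iv) (monotonicity) $\rho_{S,\tau}[\eta_1]\le\rho_{S,\tau}[\eta_2]$ if $\eta_1\le\eta_2$ a.s. (v) (consistency) $\rho_{S,\theta}[\rho_{\theta,\tau}[\eta]]=\rho_{S,\tau}[\eta]$ for $S\le\theta\le\tau$ in $\Theta$, $\eta\in L^p(\mathcal F_\tau)$. (vi) (generalized zero-one law) $\mathbf 1_A\rho_{S,\tau}[\xi(\tau)]=\mathbf 1_A\rho_{S,\tau'}[\xi(\tau')]$ for every admissible $p$-integrable family $\xi$, $A\in\mathcal F_S$, $\tau,\tau'\in\Theta_S$ with $\tau=\tau'$ on $A$. (vi bis) For every bi-admissible $p$-integrable family $\psi$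 and all Bermudan stopping times: $\mathbf 1_{\{\tau_1=\tau_1'\}}\rho_{\tau_1,\tau_1\vee\tau_2}[\psi(\tau_1,\tau_2)]=\mathbf 1_{\{\tau_1=\tau_1'\}}\rho_{\tau_1',\tau_1'\vee\tau_2}[\psi(\tau_1',\tau_2)]$ and $\mathbf 1_{\{\tau_2=\tau_2'\}}\rho_{\tau_2,\tau_1\vee\tau_2}[\psi(\tau_1,\tau_2)]=\mathbf 1_{\{\tau_2=\tau_2'\}}\rho_{\tau_2',\tau_1\vee\tau_2'}[\psi(\tau_1,\tau_2')]$. (vi ter) For every bi-admissible $p$-integrable family $\psi$, all $\tau_1,\tau_2\in\Theta$ and $A\in\mathcal F_{\tau_1\wedge\tau_2}$ such that $\tau_1\wedge\tau_2=\tau_1$ and $\tau_1\vee\tau_2=\tau_2$ a.s. on $A$: $\mathbf 1_A\rho_{\tau_1\wedge\tau_2,\tau_1\vee\tau_2}[\psi(\tau_1\wedge\tau_2,\tau_1\vee\tau_2)]=\mathbf 1_A\rho_{\tau_1\wedge\tau_2,\tau_1\vee\tau_2}[\psi(\tau_1,\tau_2)]=\mathbf 1_A\rho_{\tau_1,\tau_1\vee\tau_2}[\psi(\tau_1,\tau_2)]$, and $\mathbf 1_A\rho_{\tau_1\wedge\tau_2,\tau_1\vee\tau_2}[\psi(\tau_1\vee\tau_2,\tau_1\wedge\tau_2)]=\mathbf 1_A\rho_{\tau_1\wedge\tau_2,\tau_1\vee\tau_2}[\psi(\tau_2,\tau_1)]=\mathbf 1_A\rho_{\tau_1,\tau_1\vee\tau_2}[\psi(\tau_2,\tau_1)]$.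 (vii) (monotone Fatou property) $\rho_{S,\tau}[\eta]\le\liminf_n\rho_{S,\tau}[\eta_n]$ whenever $(\eta_n)\subset L^p(\mathcal F_\tau)$ is non-decreasing, $\sup_n\eta_n\in L^p$ and $\eta_n\uparrow\eta$ a.s. *)

theory Defs
  imports "HOL-Probability.Probability"
begin

section \<open>Essential supremum of a family of random variables\<close>

text \<open>The constant \<^const>\<open>esssup\<close> is the essential supremum of a single function (a number).
  Here we need the almost surely smallest random variable that dominates every member of a
  possibly uncountable family.  It takes values in the extended reals.\<close>

definition is_ess_sup :: "'a measure \<Rightarrow> ('a \<Rightarrow> ereal) set \<Rightarrow> ('a \<Rightarrow> ereal) \<Rightarrow> bool" where
  "is_ess_sup M X g \<longleftrightarrow>
     g \<in> borel_measurable M \<and>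
     (\<forall>f\<in>X. AE \<omega> in M. f \<omega> \<le> g \<omega>) \<and>
     (\<forall>h\<in>borel_measurable M. (\<forall>f\<in>X. AE \<omega> in M. f \<omega> \<le> h \<omega>) \<longrightarrow> (AE \<omega> in M. g \<omega> \<le> h \<omega>))"

definition ess_sup :: "'a measure \<Rightarrow> ('a \<Rightarrow> ereal) set \<Rightarrow> 'a \<Rightarrow> ereal" where
  "ess_sup M X = (SOME g. is_ess_sup M X g)"

lemma is_ess_sup_unique:
  assumes "is_ess_sup M X g" "is_ess_sup M X h"
  shows "AE \<omega> in M. g \<omega> = h \<omega>"
proof -
  have "AE \<omega> in M. g \<omega> \<le> h \<omega>" "AE \<omega> in M. h \<omega> \<le> g \<omega>"
    using assms by (auto simp: is_ess_sup_def)
  then show ?thesis by eventually_elim auto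
qed

text \<open>Existence: maximize the integral of \<open>squash\<close> of the supremum over countable subfamilies.\<close>

definition squash :: "ereal \<Rightarrow> real" where
  "squash x = (if x = \<infinity> then 2 else if x = -\<infinity> then -2 else arctan (real_of_ereal x))"

lemma arctan_bounds2: "-2 < arctan x" "arctan x < 2"
  using arctan_lbound[of x] arctan_ubound[of x] pi_less_4 by linarith+

lemma squash_bounded: "\<bar>squash x\<bar> \<le> 2"
  using arctan_bounds2[of "real_of_ereal x"] by (auto simp: squash_def abs_le_iff)

lemma squash_strict: "x < y \<Longrightarrow> squash x < squash y"
  by (cases x; cases y) (auto simp: squash_def arctan_bounds2 arctan_monotone)

lemma squash_mono: "x \<le> y \<Longrightarrow> squash x \<le> squash y"
  using squash_strict[of x y] by (metis order_le_less)

lemma measurable_squash [measurable]: "squash \<in> borel_measurable borel"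
proof -
  have "{x. squash x \<le> a} \<in> sets borel" for a
  proof -
    have 1: "{x. squash x \<le> a} = {..Sup {x. squash x \<le> a}} \<or>
          {x. squash x \<le> a} = {..<Sup {x. squash x \<le> a}}"
    proof (cases "Sup {x. squash x \<le> a} \<in> {x. squash x \<le> a}")
      case True
      then have "{x. squash x \<le> a} = {..Sup {x. squash x \<le> a}}"
        by (auto intro: Sup_upper dest: squash_mono)
      then show ?thesis by simp
    next
      case False
      have "{x. squash x \<le> a} = {..<Sup {x. squash x \<le> a}}"
      proof (intro set_eqI iffI)
        fix x assume "x \<in> {x. squash x \<le> a}"
        moreover from this have "x \<le> Sup {x. squash x \<le> a}" by (rule Sup_upper)
        ultimately show "x \<in> {..<Sup {x. squash x \<le> a}}"
          using False by (metis lessThan_iff order_le_less)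
      next
        fix x assume "x \<in> {..<Sup {x. squash x \<le> a}}"
        then obtain y where "squash y \<le> a" "x < y" by (auto simp: less_Sup_iff)
        then show "x \<in> {x. squash x \<le> a}" using squash_strict[of x y] by simp
      qed
      then show ?thesis by simp
    qed
    have "{..s} \<in> sets borel" "{..<s} \<in> sets borel" for s :: ereal by measurable
    with 1 show ?thesis by metis
  qed
  then show ?thesis by (intro borel_measurableI_le) simp
qed

lemma (in finite_measure) ess_sup_countable:
  assumes X: "X \<subseteq> borel_measurable M"
  obtains C where "countable C" "C \<subseteq> X" "is_ess_sup M X (\<lambda>\<omega>. SUP f\<in>C. f \<omega>)"
proof -
  define J where "J C = (\<integral>\<omega>. squash (SUP f\<in>C. f \<omega>) \<partial>M)" for C :: "('a \<Rightarrow> ereal) set"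
  define K where "K = {C. countable C \<and> C \<subseteq> X}"
  have meas [measurable]: "(\<lambda>\<omega>. SUP f\<in>C. f \<omega>) \<in> borel_measurable M" if "C \<in> K" for C
    using that X by (intro borel_measurable_SUP) (auto simp: K_def)
  have int: "integrable M (\<lambda>\<omega>. squash (SUP f\<in>C. f \<omega>))" if "C \<in> K" for C
    using that by (intro integrable_const_bound[where B = 2])
      (auto simp: squash_bounded intro!: measurable_compose[OF meas measurable_squash])
  have J_le: "J C \<le> J D" if "C \<subseteq> D" "C \<in> K" "D \<in> K" for C D
    unfolding J_def using that by (intro integral_mono int squash_mono SUP_subset_mono) auto
  have J_ub: "J C \<le> 2 * measure M (space M)" if "C \<in> K" for C
  proof -
    have "J C \<le> (\<integral>\<omega>. 2 \<partial>M)"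
      unfolding J_def using that
      by (intro integral_mono int) (use squash_bounded in \<open>auto simp: abs_le_iff\<close>)
    then show ?thesis by (simp add: mult.commute)
  qed
  have bdd: "bdd_above (J ` K)" using J_ub by (rule bdd_aboveI2)
  have ne: "J ` K \<noteq> {}" by (auto simp: K_def)
  define a where "a = Sup (J ` K)"
  have "\<exists>C\<in>K. a - 1 / real (Suc n) < J C" for n
    using less_cSup_iff[OF ne bdd, of "a - 1 / real (Suc n)"] by (auto simp: a_def)
  then obtain C where C: "\<And>n. C n \<in> K" "\<And>n. a - 1 / real (Suc n) < J (C n)" by metis
  define D where "D = (\<Union>n. C n)"
  have D: "D \<in> K" using C(1) by (auto simp: D_def K_def)
  have "a - 1 / real (Suc n) \<le> J D" for n
    using C(2)[of n] J_le[of "C n" D] C(1) D by (force simp: D_def)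
  then have below: "a - inverse (real (Suc n)) \<le> J D" for n
    by (simp add: inverse_eq_divide)
  have "a \<le> J D"
  proof (rule field_le_epsilon)
    fix e :: real assume "0 < e"
    then obtain n where "inverse (real (Suc n)) < e" using reals_Archimedean by blast
    with below[of n] show "a \<le> J D + e" by linarith
  qed
  have up: "AE \<omega> in M. f \<omega> \<le> (SUP f\<in>D. f \<omega>)" if f: "f \<in> X" for f
  proof -
    have E: "insert f D \<in> K" using D f by (auto simp: K_def)
    have "J (insert f D) \<le> a" unfolding a_def using E bdd by (intro cSup_upper) auto
    then have eq: "J (insert f D) = J D"
      using \<open>a \<le> J D\<close> J_le[of D "insert f D"] D E
      by (meson order_antisym order_trans subset_insertI)
    have "AE \<omega> in M. squash (SUP f\<in>insert f D. f \<omega>) - squash (SUP f\<in>D. f \<omega>) = 0"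
    proof (subst integral_nonneg_eq_0_iff_AE[symmetric])
      show "integrable M (\<lambda>\<omega>. squash (SUP f\<in>insert f D. f \<omega>) - squash (SUP f\<in>D. f \<omega>))"
        by (intro Bochner_Integration.integrable_diff int D E)
      show "AE \<omega> in M. 0 \<le> squash (SUP f\<in>insert f D. f \<omega>) - squash (SUP f\<in>D. f \<omega>)"
        by (intro AE_I2) (auto intro!: squash_mono SUP_subset_mono)
      show "(\<integral>\<omega>. squash (SUP f\<in>insert f D. f \<omega>) - squash (SUP f\<in>D. f \<omega>) \<partial>M) = 0"
        using eq by (subst Bochner_Integration.integral_diff[OF int[OF E] int[OF D]])
          (simp add: J_def)
    qed
    then show ?thesis
    proof eventually_elim
      case (elim \<omega>)
      then have "\<not> (SUP f\<in>D. f \<omega>) < (SUP f\<in>insert f D. f \<omega>)"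
        using squash_strict by fastforce
      moreover have "f \<omega> \<le> (SUP f\<in>insert f D. f \<omega>)" by (intro SUP_upper) auto
      ultimately show ?case by (meson not_less order_trans)
    qed
  qed
  have least: "AE \<omega> in M. (SUP f\<in>D. f \<omega>) \<le> h \<omega>" if "\<forall>f\<in>X. AE \<omega> in M. f \<omega> \<le> h \<omega>" for h
  proof -
    have "AE \<omega> in M. \<forall>f\<in>D. f \<omega> \<le> h \<omega>"
      using that D by (subst AE_ball_countable) (auto simp: K_def)
    then show ?thesis by eventually_elim (auto intro: SUP_least)
  qed
  have "is_ess_sup M X (\<lambda>\<omega>. SUP f\<in>D. f \<omega>)"
    unfolding is_ess_sup_def using meas[OF D] up least by blast
  with D show ?thesis by (intro that[of D]) (auto simp: K_def)
qed

lemma (in finite_measure) is_ess_sup_ess_sup: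
  assumes "X \<subseteq> borel_measurable M"
  shows "is_ess_sup M X (ess_sup M X)"
  unfolding ess_sup_def using ess_sup_countable[OF assms] by (metis someI)

section \<open>Random variables and families indexed by stopping times\<close>

text \<open>\<open>Lp p M G\<close> is the space $L^p$ of the \<open>G\<close>-measurable functions, for a
  sub-\<open>\<sigma>\<close>-algebra \<open>G\<close> of \<open>M\<close> (only the sets of \<open>G\<close> matter) and $1 \le p \le \infty$.
  Its elements are functions; equality in $L^p$ is always spelled out as equality a.e.\<close>

definition Lp :: "ennreal \<Rightarrow> 'a measure \<Rightarrow> 'a measure \<Rightarrow> ('a \<Rightarrow> real) set" where
  "Lp p M G = {f \<in> borel_measurable G.
     if p = \<infinity> then esssup M (\<lambda>\<omega>. ereal \<bar>f \<omega>\<bar>) < \<infinity>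
     else integrable M (\<lambda>\<omega>. \<bar>f \<omega>\<bar> powr enn2real p)}"

abbreviation F_at :: "'a measure \<Rightarrow> (real \<Rightarrow> 'a measure) \<Rightarrow> ('a \<Rightarrow> real) \<Rightarrow> 'a measure" where
  "F_at M F \<tau> \<equiv> filtration.pre_sigma (space M) F \<tau>"

abbreviation rv_max :: "('a \<Rightarrow> real) \<Rightarrow> ('a \<Rightarrow> real) \<Rightarrow> 'a \<Rightarrow> real" where
  "rv_max \<sigma> \<tau> \<equiv> (\<lambda>\<omega>. max (\<sigma> \<omega>) (\<tau> \<omega>))"

abbreviation rv_min :: "('a \<Rightarrow> real) \<Rightarrow> ('a \<Rightarrow> real) \<Rightarrow> 'a \<Rightarrow> real" where
  "rv_min \<sigma> \<tau> \<equiv> (\<lambda>\<omega>. min (\<sigma> \<omega>) (\<tau> \<omega>))"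

definition bermudan_times ::
  "'a measure \<Rightarrow> (real \<Rightarrow> 'a measure) \<Rightarrow> real \<Rightarrow> (nat \<Rightarrow> 'a \<Rightarrow> real) \<Rightarrow> ('a \<Rightarrow> real) set" where
  "bermudan_times M F T \<theta> =
     {\<tau>. stopping_time F \<tau> \<and> (\<forall>\<omega>\<in>space M. \<tau> \<omega> \<in> {0..T}) \<and>
        (\<exists>A B. (\<forall>k. A k \<in> sets (F_at M F (\<theta> k))) \<and> B \<in> sets (F T) \<and>
           disjoint_family A \<and> (\<forall>k. A k \<inter> B = {}) \<and> (\<Union>k. A k) \<union> B = space M \<and>
           (AE \<omega> in M. \<tau> \<omega> = (\<Sum>k. \<theta> k \<omega> * indicator (A k) \<omega>) + T * indicator B \<omega>))}"

definition times_from ::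
  "'a measure \<Rightarrow> ('a \<Rightarrow> real) set \<Rightarrow> ('a \<Rightarrow> real) \<Rightarrow> ('a \<Rightarrow> real) set" where
  "times_from M \<Theta> S = {\<nu> \<in> \<Theta>. AE \<omega> in M. S \<omega> \<le> \<nu> \<omega>}"

definition admissible ::
  "'a measure \<Rightarrow> (real \<Rightarrow> 'a measure) \<Rightarrow> ('a \<Rightarrow> real) set
    \<Rightarrow> (('a \<Rightarrow> real) \<Rightarrow> 'a \<Rightarrow> real) \<Rightarrow> bool" where
  "admissible M F \<Theta> \<xi> \<longleftrightarrow>
     (\<forall>\<tau>\<in>\<Theta>. \<xi> \<tau> \<in> borel_measurable (F_at M F \<tau>)) \<and>
     (\<forall>\<tau>\<in>\<Theta>. \<forall>\<tau>'\<in>\<Theta>. AE \<omega> in M. \<tau> \<omega> = \<tau>' \<omega> \<longrightarrow> \<xi> \<tau> \<omega> = \<xi> \<tau>' \<omega>)"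

definition p_integrable ::
  "'a measure \<Rightarrow> ennreal \<Rightarrow> ('a \<Rightarrow> real) set \<Rightarrow> (('a \<Rightarrow> real) \<Rightarrow> 'a \<Rightarrow> real) \<Rightarrow> bool" where
  "p_integrable M p \<Theta> \<xi> \<longleftrightarrow> (\<forall>\<tau>\<in>\<Theta>. \<xi> \<tau> \<in> Lp p M M)"

definition bi_admissible ::
  "'a measure \<Rightarrow> (real \<Rightarrow> 'a measure) \<Rightarrow> ('a \<Rightarrow> real) set
    \<Rightarrow> (('a \<Rightarrow> real) \<Rightarrow> ('a \<Rightarrow> real) \<Rightarrow> 'a \<Rightarrow> real) \<Rightarrow> bool" where
  "bi_admissible M F \<Theta> \<psi> \<longleftrightarrow>
     (\<forall>\<tau>1\<in>\<Theta>. \<forall>\<tau>2\<in>\<Theta>. \<psi> \<tau>1 \<tau>2 \<in> borel_measurable (F_at M F (rv_max \<tau>1 \<tau>2))) \<and>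
     (\<forall>\<tau>1\<in>\<Theta>. \<forall>\<tau>2\<in>\<Theta>. \<forall>\<sigma>1\<in>\<Theta>. \<forall>\<sigma>2\<in>\<Theta>.
        AE \<omega> in M. \<tau>1 \<omega> = \<sigma>1 \<omega> \<and> \<tau>2 \<omega> = \<sigma>2 \<omega> \<longrightarrow> \<psi> \<tau>1 \<tau>2 \<omega> = \<psi> \<sigma>1 \<sigma>2 \<omega>)"

definition bi_p_integrable ::
  "'a measure \<Rightarrow> ennreal \<Rightarrow> ('a \<Rightarrow> real) set
    \<Rightarrow> (('a \<Rightarrow> real) \<Rightarrow> ('a \<Rightarrow> real) \<Rightarrow> 'a \<Rightarrow> real) \<Rightarrow> bool" where
  "bi_p_integrable M p \<Theta> \<psi> \<longleftrightarrow> (\<forall>\<tau>1\<in>\<Theta>. \<forall>\<tau>2\<in>\<Theta>. \<psi> \<tau>1 \<tau>2 \<in> Lp p M M)"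

section \<open>The Bermudan setting and the operators\<close>

text \<open>The library's filtrations are indexed by a whole type.  The filtration below is therefore
  indexed by the reals, but only its members with index in \<open>{0..T}\<close> matter: any filtration on
  \<open>{0..T}\<close> extends to the reals (constantly on either side), and for a random time with values in
  \<open>{0..T}\<close> neither \<^const>\<open>stopping_time\<close> nor the \<open>\<sigma>\<close>-algebra \<open>F_at M F \<tau>\<close> depends on the
  extension.\<close>

locale bermudan_setting = prob_space M + complete_measure M + filtration "space M" F
  for M :: "'a measure" and F :: "real \<Rightarrow> 'a measure" +
  fixes T :: real and \<theta> :: "nat \<Rightarrow> 'a \<Rightarrow> real"
  assumes T_pos: "0 < T"
    and sets_F: "\<And>t. t \<in> {0..T} \<Longrightarrow> sets (F t) \<subseteq> sets M"
    and F_complete: "null_sets M \<subseteq> sets (F 0)"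
    and F_right_continuous: "\<And>t. t \<in> {0..<T} \<Longrightarrow> sets (F t) = (\<Inter>s\<in>{t<..T}. sets (F s))"
    and \<theta>_stopping_time: "\<And>k. stopping_time F (\<theta> k)"
    and \<theta>_range: "\<And>k \<omega>. \<omega> \<in> space M \<Longrightarrow> \<theta> k \<omega> \<in> {0..T}"
    and \<theta>_0: "AE \<omega> in M. \<theta> 0 \<omega> = 0"
    and \<theta>_mono: "\<And>k. AE \<omega> in M. \<theta> k \<omega> \<le> \<theta> (Suc k) \<omega>"
    and \<theta>_lim: "AE \<omega> in M. (\<lambda>k. \<theta> k \<omega>) \<longlonglongrightarrow> T"
begin

abbreviation \<Theta> :: "('a \<Rightarrow> real) set" where
  "\<Theta> \<equiv> bermudan_times M F T \<theta>"

abbreviation \<Theta>_from :: "('a \<Rightarrow> real) \<Rightarrow> ('a \<Rightarrow> real) set" where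
  "\<Theta>_from S \<equiv> times_from M \<Theta> S"

abbreviation LpF :: "ennreal \<Rightarrow> ('a \<Rightarrow> real) \<Rightarrow> ('a \<Rightarrow> real) set" where
  "LpF p \<tau> \<equiv> Lp p M (F_at M F \<tau>)"

end

text \<open>In \<open>fatou\<close>, the limit \<open>\<eta>\<close> is a.s. the supremum of the sequence, so that the requirement that
  this supremum be in $L^p$ is \<open>\<eta> \<in> LpF p \<tau>\<close>.\<close>

locale bermudan_operators = bermudan_setting M F T \<theta>
  for M :: "'a measure" and F T \<theta> +
  fixes p :: ennreal
    and \<rho> :: "('a \<Rightarrow> real) \<Rightarrow> ('a \<Rightarrow> real) \<Rightarrow> ('a \<Rightarrow> real) \<Rightarrow> ('a \<Rightarrow> real)"
  assumes p_ge_1: "1 \<le> p"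
    and \<rho>_Lp: "\<And>S \<tau> \<eta>. \<lbrakk>S \<in> \<Theta>; \<tau> \<in> \<Theta>; \<eta> \<in> LpF p \<tau>\<rbrakk> \<Longrightarrow> \<rho> S \<tau> \<eta> \<in> LpF p S"
    and admissibility: "\<And>S S' \<tau> \<eta>. \<lbrakk>S \<in> \<Theta>; S' \<in> \<Theta>; \<tau> \<in> \<Theta>; \<eta> \<in> LpF p \<tau>\<rbrakk> \<Longrightarrow>
      AE \<omega> in M. S \<omega> = S' \<omega> \<longrightarrow> \<rho> S \<tau> \<eta> \<omega> = \<rho> S' \<tau> \<eta> \<omega>"
    and knowledge_preservation: "\<And>S \<tau> \<eta>. \<lbrakk>S \<in> \<Theta>; \<tau> \<in> \<Theta>_from S; \<eta> \<in> LpF p S\<rbrakk> \<Longrightarrow>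
      AE \<omega> in M. \<rho> \<tau> S \<eta> \<omega> = \<eta> \<omega>"
    and monotonicity: "\<And>S \<tau> \<eta>1 \<eta>2.
      \<lbrakk>S \<in> \<Theta>; \<tau> \<in> \<Theta>; \<eta>1 \<in> LpF p \<tau>; \<eta>2 \<in> LpF p \<tau>; AE \<omega> in M. \<eta>1 \<omega> \<le> \<eta>2 \<omega>\<rbrakk> \<Longrightarrow>
      AE \<omega> in M. \<rho> S \<tau> \<eta>1 \<omega> \<le> \<rho> S \<tau> \<eta>2 \<omega>"
    and consistency: "\<And>S \<sigma> \<tau> \<eta>.
      \<lbrakk>S \<in> \<Theta>; \<sigma> \<in> \<Theta>_from S; \<tau> \<in> \<Theta>_from \<sigma>; \<eta> \<in> LpF p \<tau>\<rbrakk> \<Longrightarrow>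
      AE \<omega> in M. \<rho> S \<sigma> (\<rho> \<sigma> \<tau> \<eta>) \<omega> = \<rho> S \<tau> \<eta> \<omega>"
    and zero_one: "\<And>\<xi> S A \<tau> \<tau>'.
      \<lbrakk>admissible M F \<Theta> \<xi>; p_integrable M p \<Theta> \<xi>; S \<in> \<Theta>; A \<in> sets (F_at M F S);
       \<tau> \<in> \<Theta>_from S; \<tau>' \<in> \<Theta>_from S; AE \<omega> in M. \<omega> \<in> A \<longrightarrow> \<tau> \<omega> = \<tau>' \<omega>\<rbrakk> \<Longrightarrow>
      AE \<omega> in M. indicator A \<omega> * \<rho> S \<tau> (\<xi> \<tau>) \<omega> = indicator A \<omega> * \<rho> S \<tau>' (\<xi> \<tau>') \<omega>"
    and zero_one_bis_fst: "\<And>\<psi> \<tau>1 \<tau>1' \<tau>2.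
      \<lbrakk>bi_admissible M F \<Theta> \<psi>; bi_p_integrable M p \<Theta> \<psi>; \<tau>1 \<in> \<Theta>; \<tau>1' \<in> \<Theta>; \<tau>2 \<in> \<Theta>\<rbrakk> \<Longrightarrow>
      AE \<omega> in M. indicator {\<omega>. \<tau>1 \<omega> = \<tau>1' \<omega>} \<omega> * \<rho> \<tau>1 (rv_max \<tau>1 \<tau>2) (\<psi> \<tau>1 \<tau>2) \<omega>
        = indicator {\<omega>. \<tau>1 \<omega> = \<tau>1' \<omega>} \<omega> * \<rho> \<tau>1' (rv_max \<tau>1' \<tau>2) (\<psi> \<tau>1' \<tau>2) \<omega>"
    and zero_one_bis_snd: "\<And>\<psi> \<tau>1 \<tau>2 \<tau>2'.
      \<lbrakk>bi_admissible M F \<Theta> \<psi>; bi_p_integrable M p \<Theta> \<psi>; \<tau>1 \<in> \<Theta>; \<tau>2 \<in> \<Theta>; \<tau>2' \<in> \<Theta>\<rbrakk> \<Longrightarrow>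
      AE \<omega> in M. indicator {\<omega>. \<tau>2 \<omega> = \<tau>2' \<omega>} \<omega> * \<rho> \<tau>2 (rv_max \<tau>1 \<tau>2) (\<psi> \<tau>1 \<tau>2) \<omega>
        = indicator {\<omega>. \<tau>2 \<omega> = \<tau>2' \<omega>} \<omega> * \<rho> \<tau>2' (rv_max \<tau>1 \<tau>2') (\<psi> \<tau>1 \<tau>2') \<omega>"
    and zero_one_ter_fst: "\<And>\<psi> \<tau>1 \<tau>2 A.
      \<lbrakk>bi_admissible M F \<Theta> \<psi>; bi_p_integrable M p \<Theta> \<psi>; \<tau>1 \<in> \<Theta>; \<tau>2 \<in> \<Theta>;
       A \<in> sets (F_at M F (rv_min \<tau>1 \<tau>2));
       AE \<omega> in M. \<omega> \<in> A \<longrightarrow> rv_min \<tau>1 \<tau>2 \<omega> = \<tau>1 \<omega> \<and> rv_max \<tau>1 \<tau>2 \<omega> = \<tau>2 \<omega>\<rbrakk> \<Longrightarrow>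
      AE \<omega> in M.
        indicator A \<omega> * \<rho> (rv_min \<tau>1 \<tau>2) (rv_max \<tau>1 \<tau>2) (\<psi> (rv_min \<tau>1 \<tau>2) (rv_max \<tau>1 \<tau>2)) \<omega>
          = indicator A \<omega> * \<rho> (rv_min \<tau>1 \<tau>2) (rv_max \<tau>1 \<tau>2) (\<psi> \<tau>1 \<tau>2) \<omega> \<and>
        indicator A \<omega> * \<rho> (rv_min \<tau>1 \<tau>2) (rv_max \<tau>1 \<tau>2) (\<psi> \<tau>1 \<tau>2) \<omega>
          = indicator A \<omega> * \<rho> \<tau>1 (rv_max \<tau>1 \<tau>2) (\<psi> \<tau>1 \<tau>2) \<omega>"
    and zero_one_ter_snd: "\<And>\<psi> \<tau>1 \<tau>2 A.
      \<lbrakk>bi_admissible M F \<Theta> \<psi>; bi_p_integrable M p \<Theta> \<psi>; \<tau>1 \<in> \<Theta>; \<tau>2 \<in> \<Theta>;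
       A \<in> sets (F_at M F (rv_min \<tau>1 \<tau>2));
       AE \<omega> in M. \<omega> \<in> A \<longrightarrow> rv_min \<tau>1 \<tau>2 \<omega> = \<tau>1 \<omega> \<and> rv_max \<tau>1 \<tau>2 \<omega> = \<tau>2 \<omega>\<rbrakk> \<Longrightarrow>
      AE \<omega> in M.
        indicator A \<omega> * \<rho> (rv_min \<tau>1 \<tau>2) (rv_max \<tau>1 \<tau>2) (\<psi> (rv_max \<tau>1 \<tau>2) (rv_min \<tau>1 \<tau>2)) \<omega>
          = indicator A \<omega> * \<rho> (rv_min \<tau>1 \<tau>2) (rv_max \<tau>1 \<tau>2) (\<psi> \<tau>2 \<tau>1) \<omega> \<and>
        indicator A \<omega> * \<rho> (rv_min \<tau>1 \<tau>2) (rv_max \<tau>1 \<tau>2) (\<psi> \<tau>2 \<tau>1) \<omega>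
          = indicator A \<omega> * \<rho> \<tau>1 (rv_max \<tau>1 \<tau>2) (\<psi> \<tau>2 \<tau>1) \<omega>"
    and fatou: "\<And>S \<tau> \<eta>s \<eta>.
      \<lbrakk>S \<in> \<Theta>; \<tau> \<in> \<Theta>; \<And>n::nat. \<eta>s n \<in> LpF p \<tau>; \<eta> \<in> LpF p \<tau>;
       \<And>n. AE \<omega> in M. \<eta>s n \<omega> \<le> \<eta>s (Suc n) \<omega>; AE \<omega> in M. (\<lambda>n. \<eta>s n \<omega>) \<longlonglongrightarrow> \<eta> \<omega>\<rbrakk> \<Longrightarrow>
      AE \<omega> in M. ereal (\<rho> S \<tau> \<eta> \<omega>) \<le> liminf (\<lambda>n. ereal (\<rho> S \<tau> (\<eta>s n) \<omega>))"

section \<open>Value families\<close>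

text \<open>Essential suprema are extended-real-valued.  In \<open>value_u\<close> the operators are applied to
  \<open>\<phi>\<close>, which is real-valued a.s. as soon as \<open>value_V\<close> is, hence the \<^const>\<open>real_of_ereal\<close>.\<close>

context
  fixes M :: "'a measure" and \<Theta> :: "('a \<Rightarrow> real) set"
    and \<rho> :: "('a \<Rightarrow> real) \<Rightarrow> ('a \<Rightarrow> real) \<Rightarrow> ('a \<Rightarrow> real) \<Rightarrow> ('a \<Rightarrow> real)"
    and \<psi> :: "('a \<Rightarrow> real) \<Rightarrow> ('a \<Rightarrow> real) \<Rightarrow> 'a \<Rightarrow> real"
begin

definition value_V :: "('a \<Rightarrow> real) \<Rightarrow> 'a \<Rightarrow> ereal" where
  "value_V S = ess_sup M
     ((\<lambda>(\<tau>1, \<tau>2) \<omega>. ereal (\<rho> S (rv_max \<tau>1 \<tau>2) (\<psi> \<tau>1 \<tau>2) \<omega>))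
        ` (times_from M \<Theta> S \<times> times_from M \<Theta> S))"

definition value_v1 :: "('a \<Rightarrow> real) \<Rightarrow> 'a \<Rightarrow> ereal" where
  "value_v1 S = ess_sup M ((\<lambda>\<tau>1 \<omega>. ereal (\<rho> S \<tau>1 (\<psi> \<tau>1 S) \<omega>)) ` times_from M \<Theta> S)"

definition value_v2 :: "('a \<Rightarrow> real) \<Rightarrow> 'a \<Rightarrow> ereal" where
  "value_v2 S = ess_sup M ((\<lambda>\<tau>2 \<omega>. ereal (\<rho> S \<tau>2 (\<psi> S \<tau>2) \<omega>)) ` times_from M \<Theta> S)"

definition reward_phi :: "('a \<Rightarrow> real) \<Rightarrow> 'a \<Rightarrow> ereal" where
  "reward_phi S = (\<lambda>\<omega>. max (value_v1 S \<omega>) (value_v2 S \<omega>))"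

definition value_u :: "('a \<Rightarrow> real) \<Rightarrow> 'a \<Rightarrow> ereal" where
  "value_u S = ess_sup M
     ((\<lambda>\<tau> \<omega>. ereal (\<rho> S \<tau> (\<lambda>\<omega>. real_of_ereal (reward_phi \<tau> \<omega>)) \<omega>)) ` times_from M \<Theta> S)"

end

end

theory Submission
  imports Defs
begin

text \<open>Stopping twice amounts to stopping once at the earlier of the two times \<open>\<tau>1\<close>, \<open>\<tau>2\<close> and
collecting there the better of the two remaining single stopping problems, that is, the reward
\<open>\<phi> = max v1 v2\<close>.  The proof makes this precise by two inequalities.

First, \<open>V S \<le> u S\<close> (lemma \<open>V_le_u\<close>).  For a pair \<open>(\<tau>1, \<tau>2)\<close> put \<open>m = min \<tau>1 \<tau>2\<close> and
\<open>x = max \<tau>1 \<tau>2\<close>.  By consistency, the payoff \<open>\<psi> \<tau>1 \<tau>2\<close> can be evaluated at \<open>m\<close> first.  Where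
\<open>\<tau>1 \<le> \<tau>2\<close>, its value at \<open>m\<close> is that of \<open>\<psi> m x\<close>, which \<open>v2 m\<close> dominates; elsewhere it is that of
\<open>\<psi> x m\<close>, which \<open>v1 m\<close> dominates (lemma \<open>\<rho>_psi_min_max\<close>).  So the value at \<open>m\<close> is at most \<open>\<phi> m\<close>, and
monotonicity gives the bound by \<open>u S\<close>.

Second, the pair \<open>(\<tau>1, \<tau>2)\<close> of the theorem attains \<open>u S\<close> (lemma \<open>pasted_pair_optimal\<close>).  Its minimum is
the optimal time \<open>\<sigma>\<close> of \<open>u S\<close>; where \<open>v1 \<sigma> \<le> v2 \<sigma>\<close> it continues with the maximizer of \<open>v2 \<sigma>\<close>, and
elsewhere with that of \<open>v1 \<sigma>\<close>.  Hence its value at \<open>\<sigma>\<close> is exactly \<open>\<phi> \<sigma>\<close>, and by consistency its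
value at \<open>S\<close> is \<open>u S\<close>.  As it competes in \<open>V S\<close>, also \<open>u S \<le> V S\<close>.

The rest makes these evaluations legitimate.  Maxima, minima and pastings of Bermudan times are
Bermudan; \<open>\<phi> \<tau>\<close> is measurable for the \<open>\<sigma>\<close>-algebra of \<open>\<tau>\<close> because null sets belong to it, and it is
finite and \<open>p\<close>-integrable because it lies between one of the payoffs and \<open>V \<tau>\<close>; and the operators do not distinguish times or payoffs that agree almost surely, although
they act on functions and not on classes of functions.\<close>

section \<open>Order convexity of Lp spaces\<close>

lemma Lp_sandwich:
  assumes f: "f \<in> Lp p M M" and h: "h \<in> Lp p M M"
    and g: "g \<in> borel_measurable M"
    and fg: "AE \<omega> in M. f \<omega> \<le> g \<omega>" and gh: "AE \<omega> in M. g \<omega> \<le> h \<omega>"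
  shows "g \<in> Lp p M M"
proof (cases "p = \<infinity>")
  case True
  have f': "f \<in> borel_measurable M" "esssup M (\<lambda>\<omega>. ereal \<bar>f \<omega>\<bar>) < \<infinity>"
    and h': "h \<in> borel_measurable M" "esssup M (\<lambda>\<omega>. ereal \<bar>h \<omega>\<bar>) < \<infinity>"
    using f h True by (auto simp: Lp_def)
  define c where "c = max (esssup M (\<lambda>\<omega>. ereal \<bar>f \<omega>\<bar>)) (esssup M (\<lambda>\<omega>. ereal \<bar>h \<omega>\<bar>))"
  have "AE \<omega> in M. ereal \<bar>g \<omega>\<bar> \<le> c"
    using esssup_AE[of "\<lambda>\<omega>. ereal \<bar>f \<omega>\<bar>" M] esssup_AE[of "\<lambda>\<omega>. ereal \<bar>h \<omega>\<bar>" M] fg gh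
  proof eventually_elim
    case (elim \<omega>)
    have "ereal \<bar>g \<omega>\<bar> \<le> max (ereal \<bar>f \<omega>\<bar>) (ereal \<bar>h \<omega>\<bar>)"
      using elim(3,4) by (auto simp: le_max_iff_disj)
    also have "\<dots> \<le> c"
      unfolding c_def using elim(1,2) by (rule max.mono)
    finally show ?case .
  qed
  then have "esssup M (\<lambda>\<omega>. ereal \<bar>g \<omega>\<bar>) \<le> c"
    using g by (intro esssup_I) auto
  also have "c < \<infinity>"
    using f'(2) h'(2) by (simp only: c_def max_less_iff_conj)
  finally show ?thesis
    using g True by (simp add: Lp_def)
next
  case False
  define q where "q = enn2real p"
  have "q \<ge> 0"
    by (simp add: q_def)
  have "integrable M (\<lambda>\<omega>. \<bar>f \<omega>\<bar> powr q + \<bar>h \<omega>\<bar> powr q)"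
    using f h False by (auto simp: Lp_def q_def)
  then have "integrable M (\<lambda>\<omega>. \<bar>g \<omega>\<bar> powr q)"
  proof (rule Bochner_Integration.integrable_bound)
    show "(\<lambda>\<omega>. \<bar>g \<omega>\<bar> powr q) \<in> borel_measurable M"
      using g by measurable
    show "AE \<omega> in M. norm (\<bar>g \<omega>\<bar> powr q) \<le> norm (\<bar>f \<omega>\<bar> powr q + \<bar>h \<omega>\<bar> powr q)"
      using fg gh
    proof eventually_elim
      case (elim \<omega>)
      then have "\<bar>g \<omega>\<bar> \<le> \<bar>f \<omega>\<bar> \<or> \<bar>g \<omega>\<bar> \<le> \<bar>h \<omega>\<bar>"
        by linarith
      then have "\<bar>g \<omega>\<bar> powr q \<le> \<bar>f \<omega>\<bar> powr q \<or> \<bar>g \<omega>\<bar> powr q \<le> \<bar>h \<omega>\<bar> powr q"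
        using \<open>q \<ge> 0\<close> by (auto intro: powr_mono2)
      moreover have "0 \<le> \<bar>f \<omega>\<bar> powr q" "0 \<le> \<bar>h \<omega>\<bar> powr q"
        by auto
      ultimately show ?case
        by (elim disjE) (simp_all add: add_increasing add_increasing2)
    qed
  qed
  then show ?thesis
    using g False by (simp add: Lp_def q_def)
qed

lemma Lp_dominated:
  assumes f: "f \<in> Lp p M M" and g: "g \<in> borel_measurable M" and le: "AE \<omega> in M. \<bar>g \<omega>\<bar> \<le> \<bar>f \<omega>\<bar>"
  shows "g \<in> Lp p M M"
proof (rule Lp_sandwich[OF _ _ g])
  show "(\<lambda>\<omega>. - \<bar>f \<omega>\<bar>) \<in> Lp p M M" "(\<lambda>\<omega>. \<bar>f \<omega>\<bar>) \<in> Lp p M M"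
    using f unfolding Lp_def mem_Collect_eq abs_minus_cancel abs_idempotent
    by (auto intro: borel_measurable_abs borel_measurable_uminus)
  show "AE \<omega> in M. - \<bar>f \<omega>\<bar> \<le> g \<omega>"
    using le by eventually_elim linarith
  show "AE \<omega> in M. g \<omega> \<le> \<bar>f \<omega>\<bar>"
    using le by eventually_elim linarith
qed

section \<open>Sigma-algebras of stopping times\<close>

context filtration
begin

lemma sets_stopped_leq:
  assumes \<sigma>: "stopping_time F \<sigma>" and \<tau>: "stopping_time F \<tau>"
  shows "{\<omega> \<in> \<Omega>. \<sigma> \<omega> \<le> \<tau> \<omega>} \<in> sets (pre_sigma \<tau>)"
proof -
  have "{\<omega> \<in> \<Omega>. \<tau> \<omega> < \<sigma> \<omega>} \<in> sets (pre_sigma \<tau>)"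
    using stopping_time_less[OF \<tau> \<sigma>] by (simp add: pred_def space_pre_sigma)
  then have "space (pre_sigma \<tau>) - {\<omega> \<in> \<Omega>. \<tau> \<omega> < \<sigma> \<omega>} \<in> sets (pre_sigma \<tau>)"
    by blast
  also have "space (pre_sigma \<tau>) - {\<omega> \<in> \<Omega>. \<tau> \<omega> < \<sigma> \<omega>} = {\<omega> \<in> \<Omega>. \<sigma> \<omega> \<le> \<tau> \<omega>}"
    by (auto simp: space_pre_sigma)
  finally show ?thesis .
qed

text \<open>On the event \<open>\<sigma> \<le> \<tau>\<close> the times \<open>\<tau>\<close> and \<open>max \<sigma> \<tau>\<close> agree, and the \<open>\<sigma>\<close>-algebra of \<open>max \<sigma> \<tau>\<close> contains that
of \<open>\<sigma>\<close>.\<close>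

lemma sets_pre_sigma_transfer:
  assumes \<sigma>: "stopping_time F \<sigma>" and \<tau>: "stopping_time F \<tau>" and A: "A \<in> sets (pre_sigma \<sigma>)"
  shows "{\<omega> \<in> A. \<sigma> \<omega> \<le> \<tau> \<omega>} \<in> sets (pre_sigma \<tau>)"
proof (rule sets_pre_sigmaI[OF \<tau>])
  fix t
  let ?m = "\<lambda>\<omega>. max (\<sigma> \<omega>) (\<tau> \<omega>)"
  have m: "stopping_time F ?m"
    by (intro stopping_time_max \<sigma> \<tau>)
  have "A \<in> sets (pre_sigma ?m)"
    using mono_pre_sigma[OF \<sigma> m] A by auto
  moreover have "{\<omega> \<in> \<Omega>. \<sigma> \<omega> \<le> \<tau> \<omega>} \<in> sets (pre_sigma ?m)"
    using mono_pre_sigma[OF \<tau> m] sets_stopped_leq[OF \<sigma> \<tau>] by auto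
  ultimately have "A \<inter> {\<omega> \<in> \<Omega>. \<sigma> \<omega> \<le> \<tau> \<omega>} \<in> sets (pre_sigma ?m)"
    by blast
  then have "{\<omega> \<in> A \<inter> {\<omega> \<in> \<Omega>. \<sigma> \<omega> \<le> \<tau> \<omega>}. ?m \<omega> \<le> t} \<in> sets (F t)"
    by (rule sets_pre_sigmaD[OF m])
  also have "{\<omega> \<in> A \<inter> {\<omega> \<in> \<Omega>. \<sigma> \<omega> \<le> \<tau> \<omega>}. ?m \<omega> \<le> t} = {\<omega> \<in> {\<omega> \<in> A. \<sigma> \<omega> \<le> \<tau> \<omega>}. \<tau> \<omega> \<le> t}"
    using sets.sets_into_space[OF A] by (auto simp: space_pre_sigma)
  finally show "{\<omega> \<in> {\<omega> \<in> A. \<sigma> \<omega> \<le> \<tau> \<omega>}. \<tau> \<omega> \<le> t} \<in> sets (F t)" .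
qed

lemma sets_stopped_eq:
  assumes \<sigma>: "stopping_time F \<sigma>" and \<tau>: "stopping_time F \<tau>"
  shows "{\<omega> \<in> \<Omega>. \<sigma> \<omega> = \<tau> \<omega>} \<in> sets (pre_sigma \<tau>)"
proof -
  have "{\<omega> \<in> {\<omega> \<in> \<Omega>. \<tau> \<omega> \<le> \<sigma> \<omega>}. \<sigma> \<omega> \<le> \<tau> \<omega>} \<in> sets (pre_sigma \<tau>)"
    by (intro sets_pre_sigma_transfer \<sigma> \<tau> sets_stopped_leq)
  also have "{\<omega> \<in> {\<omega> \<in> \<Omega>. \<tau> \<omega> \<le> \<sigma> \<omega>}. \<sigma> \<omega> \<le> \<tau> \<omega>} = {\<omega> \<in> \<Omega>. \<sigma> \<omega> = \<tau> \<omega>}"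
    by auto
  finally show ?thesis .
qed

lemma measurable_pre_sigma_transfer:
  fixes f :: "'a \<Rightarrow> real"
  assumes \<sigma>: "stopping_time F \<sigma>" and \<tau>: "stopping_time F \<tau>"
    and f: "f \<in> borel_measurable (pre_sigma \<sigma>)"
  shows "(\<lambda>\<omega>. if \<sigma> \<omega> \<le> \<tau> \<omega> then f \<omega> else 0) \<in> borel_measurable (pre_sigma \<tau>)"
proof (rule measurableI)
  fix U :: "real set" assume U: "U \<in> sets borel"
  let ?L = "{\<omega> \<in> \<Omega>. \<sigma> \<omega> \<le> \<tau> \<omega>}"
  have 1: "{\<omega> \<in> f -` U \<inter> \<Omega>. \<sigma> \<omega> \<le> \<tau> \<omega>} \<in> sets (pre_sigma \<tau>)"
    using measurable_sets[OF f U] by (intro sets_pre_sigma_transfer \<sigma> \<tau>) (simp add: space_pre_sigma)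
  have 2: "space (pre_sigma \<tau>) - ?L \<in> sets (pre_sigma \<tau>)"
    using sets_stopped_leq[OF \<sigma> \<tau>] by blast
  have "(\<lambda>\<omega>. if \<sigma> \<omega> \<le> \<tau> \<omega> then f \<omega> else 0) -` U \<inter> space (pre_sigma \<tau>) =
      {\<omega> \<in> f -` U \<inter> \<Omega>. \<sigma> \<omega> \<le> \<tau> \<omega>} \<union> (if 0 \<in> U then space (pre_sigma \<tau>) - ?L else {})"
    by (auto simp: space_pre_sigma split: if_splits)
  also have "\<dots> \<in> sets (pre_sigma \<tau>)"
    using sets.Un[OF 1 2] 1 by simp
  finally show "(\<lambda>\<omega>. if \<sigma> \<omega> \<le> \<tau> \<omega> then f \<omega> else 0) -` U \<inter> space (pre_sigma \<tau>) \<in> sets (pre_sigma \<tau>)" .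
qed simp

end

section \<open>Bermudan stopping times up to null sets\<close>

context bermudan_setting
begin

lemma bermudan_timesD:
  assumes "\<tau> \<in> \<Theta>"
  shows "stopping_time F \<tau>" "\<And>\<omega>. \<omega> \<in> space M \<Longrightarrow> 0 \<le> \<tau> \<omega>" "\<And>\<omega>. \<omega> \<in> space M \<Longrightarrow> \<tau> \<omega> \<le> T"
  using assms by (auto simp: bermudan_times_def)

lemma sets_F_at_subset_F_T:
  assumes \<tau>: "stopping_time F \<tau>" "\<And>\<omega>. \<omega> \<in> space M \<Longrightarrow> \<tau> \<omega> \<le> T"
  shows "sets (F_at M F \<tau>) \<subseteq> sets (F T)"
proof
  fix A assume A: "A \<in> sets (F_at M F \<tau>)"
  have "{\<omega> \<in> A. \<tau> \<omega> \<le> T} \<in> sets (F T)"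
    using \<tau>(1) A by (rule sets_pre_sigmaD)
  also have "{\<omega> \<in> A. \<tau> \<omega> \<le> T} = A"
    using sets.sets_into_space[OF A] \<tau>(2) by (auto simp: space_pre_sigma)
  finally show "A \<in> sets (F T)" .
qed

lemma sets_F_at_subset:
  assumes "\<tau> \<in> \<Theta>"
  shows "sets (F_at M F \<tau>) \<subseteq> sets M"
  using sets_F_at_subset_F_T[of \<tau>] bermudan_timesD[OF assms] sets_F[of T] T_pos by auto

lemma F_at_measurable_imp:
  fixes f :: "'a \<Rightarrow> 'b::topological_space"
  assumes "\<tau> \<in> \<Theta>" "f \<in> borel_measurable (F_at M F \<tau>)"
  shows "f \<in> borel_measurable M"
  using assms sets_F_at_subset[OF assms(1)]
  by (intro measurable_from_subalg[of M "F_at M F \<tau>"]) (auto simp: subalgebra_def space_pre_sigma)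

lemma null_sets_F:
  assumes "N \<in> null_sets M" "0 \<le> t"
  shows "N \<in> sets (F t)"
  using assms F_complete sets_F_mono[of 0 t] by auto

text \<open>Completeness of the filtration puts the null sets into \<open>F 0\<close>, hence into the \<open>\<sigma>\<close>-algebra of every
nonnegative stopping time.  Through the lemmas below, this lets every order relation between
stopping times, and every equality of random variables, be weakened to an almost sure one.\<close>

lemma null_sets_F_at:
  assumes \<tau>: "\<tau> \<in> \<Theta>" and N: "N \<in> null_sets M"
  shows "N \<in> sets (F_at M F \<tau>)"
proof (rule sets_pre_sigmaI)
  show "stopping_time F \<tau>"
    using \<tau> by (rule bermudan_timesD)
  fix t
  have sub: "N \<subseteq> space M"
    using N by (auto dest: sets.sets_into_space)
  show "{\<omega> \<in> N. \<tau> \<omega> \<le> t} \<in> sets (F t)"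
  proof (cases "0 \<le> t")
    case True
    have "{\<omega> \<in> N. \<tau> \<omega> \<le> t} \<in> null_sets M"
      using N by (rule complete2[rotated]) auto
    then show ?thesis
      using True by (rule null_sets_F)
  next
    case False
    have "t < \<tau> \<omega>" if "\<omega> \<in> N" for \<omega>
      using False bermudan_timesD(2)[OF \<tau>, of \<omega>] sub that by force
    then have "{\<omega> \<in> N. \<tau> \<omega> \<le> t} = {}"
      by force
    then show ?thesis
      by (simp only: sets.empty_sets)
  qed
qed

lemma sets_F_at_AE_cong:
  assumes \<tau>: "\<tau> \<in> \<Theta>" and A: "A \<in> sets (F_at M F \<tau>)"
    and A': "A' \<subseteq> space M" and eq: "AE \<omega> in M. \<omega> \<in> A \<longleftrightarrow> \<omega> \<in> A'"
  shows "A' \<in> sets (F_at M F \<tau>)"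
proof -
  have "{\<omega> \<in> space M. \<not> (\<omega> \<in> A \<longleftrightarrow> \<omega> \<in> A')} \<in> null_sets M"
    using eq by (simp add: AE_iff_null_sets)
  moreover have "A - A' \<subseteq> {\<omega> \<in> space M. \<not> (\<omega> \<in> A \<longleftrightarrow> \<omega> \<in> A')}"
      "A' - A \<subseteq> {\<omega> \<in> space M. \<not> (\<omega> \<in> A \<longleftrightarrow> \<omega> \<in> A')}"
    using sets.sets_into_space[OF A] A' by (auto simp: space_pre_sigma)
  ultimately have "A - A' \<in> null_sets M" "A' - A \<in> null_sets M"
    by (simp_all only: complete2)
  then have "(A - (A - A')) \<union> (A' - A) \<in> sets (F_at M F \<tau>)"
    by (intro sets.Un sets.Diff A null_sets_F_at[OF \<tau>])
  also have "(A - (A - A')) \<union> (A' - A) = A'"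
    by auto
  finally show ?thesis .
qed

lemma measurable_F_at_AE_cong:
  fixes f g :: "'a \<Rightarrow> 'b::topological_space"
  assumes \<tau>: "\<tau> \<in> \<Theta>" and f: "f \<in> borel_measurable (F_at M F \<tau>)"
    and eq: "AE \<omega> in M. f \<omega> = g \<omega>"
  shows "g \<in> borel_measurable (F_at M F \<tau>)"
proof (rule measurableI)
  fix U :: "'b set" assume U: "U \<in> sets borel"
  show "g -` U \<inter> space (F_at M F \<tau>) \<in> sets (F_at M F \<tau>)"
  proof (rule sets_F_at_AE_cong[OF \<tau> measurable_sets[OF f U]])
    show "AE \<omega> in M. (\<omega> \<in> f -` U \<inter> space (F_at M F \<tau>)) = (\<omega> \<in> g -` U \<inter> space (F_at M F \<tau>))"
      using eq by eventually_elim auto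
  qed (simp add: space_pre_sigma)
qed simp

lemma measurable_F_at_AE_mono:
  fixes f :: "'a \<Rightarrow> real"
  assumes \<sigma>: "\<sigma> \<in> \<Theta>" and \<tau>: "\<tau> \<in> \<Theta>" and le: "AE \<omega> in M. \<sigma> \<omega> \<le> \<tau> \<omega>"
    and f: "f \<in> borel_measurable (F_at M F \<sigma>)"
  shows "f \<in> borel_measurable (F_at M F \<tau>)"
proof (rule measurable_F_at_AE_cong[OF \<tau>])
  show "(\<lambda>\<omega>. if \<sigma> \<omega> \<le> \<tau> \<omega> then f \<omega> else 0) \<in> borel_measurable (F_at M F \<tau>)"
    using \<sigma> \<tau> f by (intro measurable_pre_sigma_transfer bermudan_timesD)
  show "AE \<omega> in M. (if \<sigma> \<omega> \<le> \<tau> \<omega> then f \<omega> else 0) = f \<omega>"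
    using le by eventually_elim simp
qed

lemma sets_F_at_AE_mono:
  assumes \<sigma>: "\<sigma> \<in> \<Theta>" and \<tau>: "\<tau> \<in> \<Theta>" and le: "AE \<omega> in M. \<sigma> \<omega> \<le> \<tau> \<omega>"
    and A: "A \<in> sets (F_at M F \<sigma>)"
  shows "A \<in> sets (F_at M F \<tau>)"
proof (rule sets_F_at_AE_cong[OF \<tau>])
  show "{\<omega> \<in> A. \<sigma> \<omega> \<le> \<tau> \<omega>} \<in> sets (F_at M F \<tau>)"
    using \<sigma> \<tau> A by (intro sets_pre_sigma_transfer bermudan_timesD)
  show "AE \<omega> in M. (\<omega> \<in> {\<omega> \<in> A. \<sigma> \<omega> \<le> \<tau> \<omega>}) = (\<omega> \<in> A)"
    using le by eventually_elim simp
  show "A \<subseteq> space M"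
    using sets.sets_into_space[OF A] by (simp add: space_pre_sigma)
qed

text \<open>A partition witnessing that \<open>\<tau>\<close> is Bermudan can be recovered from \<open>\<tau>\<close>: the piece \<open>A k\<close> is the event
that \<open>k\<close> is the first index with \<open>\<tau> = \<theta> k\<close>.  It belongs to the \<open>\<sigma>\<close>-algebra of \<open>\<theta> k\<close> although
\<open>\<theta> j \<le> \<theta> k\<close> for \<open>j < k\<close> may fail on a null set: on \<open>\<tau> = \<theta> k\<close> the condition \<open>\<tau> \<noteq> \<theta> j\<close> is
\<open>\<theta> j \<noteq> \<theta> k\<close>.  In this pointwise form, closure under maxima, minima and pasting is evident.\<close>

lemma bermudan_times_iff:
  "\<tau> \<in> \<Theta> \<longleftrightarrow> stopping_time F \<tau> \<and> (\<forall>\<omega>\<in>space M. \<tau> \<omega> \<in> {0..T}) \<and>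
    (AE \<omega> in M. (\<exists>k. \<tau> \<omega> = \<theta> k \<omega>) \<or> \<tau> \<omega> = T)"
proof (intro iffI conjI)
  assume \<tau>: "\<tau> \<in> \<Theta>"
  then show "stopping_time F \<tau>" "\<forall>\<omega>\<in>space M. \<tau> \<omega> \<in> {0..T}"
    by (auto simp: bermudan_times_def)
  from \<tau> obtain A B where disj: "disjoint_family A" "\<forall>k. A k \<inter> B = {}"
    and un: "(\<Union>k. A k) \<union> B = space M"
    and eq: "AE \<omega> in M. \<tau> \<omega> = (\<Sum>k. \<theta> k \<omega> * indicator (A k) \<omega>) + T * indicator B \<omega>"
    by (auto simp: bermudan_times_def)
  show "AE \<omega> in M. (\<exists>k. \<tau> \<omega> = \<theta> k \<omega>) \<or> \<tau> \<omega> = T"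
    using eq AE_space
  proof eventually_elim
    case (elim \<omega>)
    show ?case
    proof (cases "\<omega> \<in> B")
      case True
      then have "\<And>k. \<omega> \<notin> A k"
        using disj(2) by blast
      then show ?thesis
        using elim True by simp
    next
      case False
      then obtain k where k: "\<omega> \<in> A k"
        using un elim by blast
      then have "\<And>j. j \<noteq> k \<Longrightarrow> \<omega> \<notin> A j"
        using disj(1) by (auto simp: disjoint_family_on_def)
      then have "(\<Sum>k. \<theta> k \<omega> * indicator (A k) \<omega>) = (\<Sum>k\<in>{k}. \<theta> k \<omega> * indicator (A k) \<omega>)"
        by (intro suminf_finite) auto
      then show ?thesis
        using elim k False by auto
    qed
  qed
next
  assume *: "stopping_time F \<tau> \<and> (\<forall>\<omega>\<in>space M. \<tau> \<omega> \<in> {0..T}) \<and>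
    (AE \<omega> in M. (\<exists>k. \<tau> \<omega> = \<theta> k \<omega>) \<or> \<tau> \<omega> = T)"
  then have \<tau>: "stopping_time F \<tau>"
    by blast
  define A where "A k = {\<omega> \<in> space M. \<tau> \<omega> = \<theta> k \<omega>} - (\<Union>j<k. {\<omega> \<in> space M. \<theta> j \<omega> = \<theta> k \<omega>})" for k
  define B where "B = space M - (\<Union>k. {\<omega> \<in> space M. \<tau> \<omega> = \<theta> k \<omega>})"
  have eq_sets: "{\<omega> \<in> space M. \<tau> \<omega> = \<theta> k \<omega>} \<in> sets (F_at M F (\<theta> k))" for k
    by (intro sets_stopped_eq \<tau> \<theta>_stopping_time)
  have \<theta>_eq_sets: "{\<omega> \<in> space M. \<theta> j \<omega> = \<theta> k \<omega>} \<in> sets (F_at M F (\<theta> k))" for j k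
    by (intro sets_stopped_eq \<theta>_stopping_time)
  have A: "A k \<in> sets (F_at M F (\<theta> k))" for k
    unfolding A_def using \<theta>_eq_sets by (intro sets.Diff eq_sets sets.finite_UN) auto
  have "{\<omega> \<in> space M. \<tau> \<omega> = \<theta> k \<omega>} \<in> sets (F T)" for k
    using eq_sets[of k] sets_F_at_subset_F_T[OF \<theta>_stopping_time[of k]] \<theta>_range by force
  then have B: "B \<in> sets (F T)"
    unfolding B_def space_F[of T, symmetric] by (intro sets.Diff sets.countable_UN' sets.top) auto
  have AD: "\<tau> \<omega> = \<theta> k \<omega>" "\<And>j. j < k \<Longrightarrow> \<tau> \<omega> \<noteq> \<theta> j \<omega>" "\<omega> \<in> space M" if "\<omega> \<in> A k" for \<omega> k
    using that by (auto simp: A_def)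
  have least: "\<exists>j. \<omega> \<in> A j" if \<omega>: "\<omega> \<in> space M" "\<tau> \<omega> = \<theta> k \<omega>" for k \<omega>
  proof -
    obtain j where j: "\<tau> \<omega> = \<theta> j \<omega>" "\<And>i. i < j \<Longrightarrow> \<tau> \<omega> \<noteq> \<theta> i \<omega>"
      using exists_least_iff[of "\<lambda>k. \<tau> \<omega> = \<theta> k \<omega>"] \<omega>(2) by blast
    have "\<omega> \<notin> {\<omega> \<in> space M. \<theta> i \<omega> = \<theta> j \<omega>}" if "i < j" for i
      using j(1) j(2)[OF that] by simp
    then have "\<omega> \<in> A j"
      using \<omega>(1) j(1) unfolding A_def by blast
    then show ?thesis ..
  qed
  have disj: "disjoint_family A"
    unfolding disjoint_family_on_def
  proof (intro ballI impI)
    fix i j :: nat assume ij: "i \<noteq> j"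
    have "False" if \<omega>: "\<omega> \<in> A i" "\<omega> \<in> A j" for \<omega>
      using ij AD(2)[OF \<omega>(1), of j] AD(2)[OF \<omega>(2), of i] AD(1)[OF \<omega>(1)] AD(1)[OF \<omega>(2)]
      by linarith
    then show "A i \<inter> A j = {}"
      by blast
  qed
  have AB: "\<forall>k. A k \<inter> B = {}"
    by (auto simp: A_def B_def)
  have un: "(\<Union>k. A k) \<union> B = space M"
    using least AD(3) by (auto simp: B_def)
  have "AE \<omega> in M. (\<exists>k. \<tau> \<omega> = \<theta> k \<omega>) \<or> \<tau> \<omega> = T"
    using * by blast
  then have "AE \<omega> in M. \<tau> \<omega> = (\<Sum>k. \<theta> k \<omega> * indicator (A k) \<omega>) + T * indicator B \<omega>"
    using AE_space
  proof eventually_elim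
    case (elim \<omega>)
    show ?case
    proof (cases "\<exists>k. \<omega> \<in> A k")
      case True
      then obtain k where k: "\<omega> \<in> A k" ..
      then have "\<And>j. j \<noteq> k \<Longrightarrow> \<omega> \<notin> A j"
        using disj by (auto simp: disjoint_family_on_def)
      then have "(\<Sum>k. \<theta> k \<omega> * indicator (A k) \<omega>) = (\<Sum>k\<in>{k}. \<theta> k \<omega> * indicator (A k) \<omega>)"
        by (intro suminf_finite) auto
      moreover have "\<omega> \<notin> B"
        using k AB by blast
      ultimately show ?thesis
        using AD(1)[OF k] k by simp
    next
      case False
      then have "\<omega> \<in> B"
        using un elim by blast
      moreover have "\<tau> \<omega> = T"
        using elim False least by blast
      ultimately show ?thesis
        using False by simp
    qed
  qed
  then show "\<tau> \<in> \<Theta>"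
    unfolding bermudan_times_def using * A B disj AB un by blast
qed

lemma rv_max_bermudan:
  assumes "\<sigma> \<in> \<Theta>" "\<tau> \<in> \<Theta>"
  shows "rv_max \<sigma> \<tau> \<in> \<Theta>"
proof -
  have "AE \<omega> in M. (\<exists>k. \<sigma> \<omega> = \<theta> k \<omega>) \<or> \<sigma> \<omega> = T" "AE \<omega> in M. (\<exists>k. \<tau> \<omega> = \<theta> k \<omega>) \<or> \<tau> \<omega> = T"
    using assms by (simp_all add: bermudan_times_iff)
  then have "AE \<omega> in M. (\<exists>k. rv_max \<sigma> \<tau> \<omega> = \<theta> k \<omega>) \<or> rv_max \<sigma> \<tau> \<omega> = T"
    by eventually_elim (simp add: max_def)
  then show ?thesis
    using assms by (auto simp: bermudan_times_iff le_max_iff_disj intro: stopping_time_max)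
qed

lemma rv_min_bermudan:
  assumes "\<sigma> \<in> \<Theta>" "\<tau> \<in> \<Theta>"
  shows "rv_min \<sigma> \<tau> \<in> \<Theta>"
proof -
  have "AE \<omega> in M. (\<exists>k. \<sigma> \<omega> = \<theta> k \<omega>) \<or> \<sigma> \<omega> = T" "AE \<omega> in M. (\<exists>k. \<tau> \<omega> = \<theta> k \<omega>) \<or> \<tau> \<omega> = T"
    using assms by (simp_all add: bermudan_times_iff)
  then have "AE \<omega> in M. (\<exists>k. rv_min \<sigma> \<tau> \<omega> = \<theta> k \<omega>) \<or> rv_min \<sigma> \<tau> \<omega> = T"
    by eventually_elim (simp add: min_def)
  then show ?thesis
    using assms by (auto simp: bermudan_times_iff min_le_iff_disj intro: stopping_time_min)
qed

text \<open>The pasted function is a stopping time because \<open>A\<close> is already known at \<open>S\<close>, hence at the later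
times \<open>\<sigma>\<close> and \<open>\<tau>\<close>.\<close>

lemma bermudan_paste:
  assumes S: "S \<in> \<Theta>" and \<sigma>: "\<sigma> \<in> \<Theta>_from S" and \<tau>: "\<tau> \<in> \<Theta>_from S" and A: "A \<in> sets (F_at M F S)"
  shows "(\<lambda>\<omega>. \<sigma> \<omega> * indicator A \<omega> + \<tau> \<omega> * indicator (space M - A) \<omega>) \<in> \<Theta>_from S"
    (is "?\<nu> \<in> _")
proof -
  have st: "\<sigma> \<in> \<Theta>" "\<tau> \<in> \<Theta>" and le: "AE \<omega> in M. S \<omega> \<le> \<sigma> \<omega>" "AE \<omega> in M. S \<omega> \<le> \<tau> \<omega>"
    using \<sigma> \<tau> by (auto simp: times_from_def)
  have A_sub: "A \<subseteq> space M"
    using sets.sets_into_space[OF A] by (simp add: space_pre_sigma)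
  have Ac: "space M - A \<in> sets (F_at M F S)"
    using sets.compl_sets[OF A] by (simp add: space_pre_sigma)
  have "stopping_time F ?\<nu>"
  proof (rule stopping_timeI)
    fix t
    have "{\<omega> \<in> A. \<sigma> \<omega> \<le> t} \<in> sets (F t)"
      using bermudan_timesD(1)[OF st(1)] sets_F_at_AE_mono[OF S st(1) le(1) A]
      by (rule sets_pre_sigmaD)
    moreover have "{\<omega> \<in> space M - A. \<tau> \<omega> \<le> t} \<in> sets (F t)"
      using bermudan_timesD(1)[OF st(2)] sets_F_at_AE_mono[OF S st(2) le(2) Ac]
      by (rule sets_pre_sigmaD)
    ultimately have "{\<omega> \<in> A. \<sigma> \<omega> \<le> t} \<union> {\<omega> \<in> space M - A. \<tau> \<omega> \<le> t} \<in> sets (F t)"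
      by blast
    also have "{\<omega> \<in> A. \<sigma> \<omega> \<le> t} \<union> {\<omega> \<in> space M - A. \<tau> \<omega> \<le> t} = {\<omega> \<in> space M. ?\<nu> \<omega> \<le> t}"
      using A_sub by (auto simp: indicator_def)
    finally show "Measurable.pred (F t) (\<lambda>\<omega>. ?\<nu> \<omega> \<le> t)"
      by (simp add: pred_def space_F)
  qed
  moreover have "\<forall>\<omega>\<in>space M. ?\<nu> \<omega> \<in> {0..T}"
    using bermudan_timesD(2,3)[OF st(1)] bermudan_timesD(2,3)[OF st(2)]
    by (auto simp: indicator_def)
  moreover have "AE \<omega> in M. (\<exists>k. ?\<nu> \<omega> = \<theta> k \<omega>) \<or> ?\<nu> \<omega> = T"
  proof -
    have "AE \<omega> in M. (\<exists>k. \<sigma> \<omega> = \<theta> k \<omega>) \<or> \<sigma> \<omega> = T" "AE \<omega> in M. (\<exists>k. \<tau> \<omega> = \<theta> k \<omega>) \<or> \<tau> \<omega> = T"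
      using st by (auto simp: bermudan_times_iff)
    then show ?thesis
      using AE_space by eventually_elim (auto simp: indicator_def)
  qed
  moreover have "AE \<omega> in M. S \<omega> \<le> ?\<nu> \<omega>"
    using le AE_space by eventually_elim (auto simp: indicator_def)
  ultimately show ?thesis
    by (simp add: times_from_def bermudan_times_iff)
qed

lemma rv_max_commute: "rv_max \<sigma> \<tau> = rv_max \<tau> \<sigma>"
  by (simp add: max.commute)

lemma times_from_self: "\<sigma> \<in> \<Theta> \<Longrightarrow> \<sigma> \<in> \<Theta>_from \<sigma>"
  by (simp add: times_from_def)

lemma times_from_trans:
  assumes "\<sigma> \<in> \<Theta>_from S" "\<tau> \<in> \<Theta>_from \<sigma>"
  shows "\<tau> \<in> \<Theta>_from S"
proof -
  have "AE \<omega> in M. S \<omega> \<le> \<sigma> \<omega>" "AE \<omega> in M. \<sigma> \<omega> \<le> \<tau> \<omega>" "\<tau> \<in> \<Theta>"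
    using assms by (simp_all add: times_from_def)
  moreover from this(1,2) have "AE \<omega> in M. S \<omega> \<le> \<tau> \<omega>"
    by eventually_elim simp
  ultimately show ?thesis
    by (simp add: times_from_def)
qed

lemma LpF_iff:
  assumes "\<tau> \<in> \<Theta>"
  shows "f \<in> LpF p \<tau> \<longleftrightarrow> f \<in> borel_measurable (F_at M F \<tau>) \<and> f \<in> Lp p M M"
  unfolding Lp_def mem_Collect_eq using F_at_measurable_imp[OF assms, of f] by blast

lemma LpFI: "\<tau> \<in> \<Theta> \<Longrightarrow> f \<in> borel_measurable (F_at M F \<tau>) \<Longrightarrow> f \<in> Lp p M M \<Longrightarrow> f \<in> LpF p \<tau>"
  by (rule LpF_iff[THEN iffD2, OF _ conjI])

lemma LpFD:
  assumes "f \<in> LpF p \<tau>" "\<tau> \<in> \<Theta>"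
  shows "f \<in> borel_measurable (F_at M F \<tau>)" "f \<in> Lp p M M"
  using assms(1) unfolding LpF_iff[OF assms(2)] by blast+

lemma LpF_AE_mono:
  assumes "\<sigma> \<in> \<Theta>" "\<tau> \<in> \<Theta>" "AE \<omega> in M. \<sigma> \<omega> \<le> \<tau> \<omega>" "\<eta> \<in> LpF p \<sigma>"
  shows "\<eta> \<in> LpF p \<tau>"
  using assms(4) measurable_F_at_AE_mono[OF assms(1-3), of \<eta>]
  unfolding LpF_iff[OF assms(1)] LpF_iff[OF assms(2)] by blast

text \<open>An essential supremum is only required to be measurable for \<open>M\<close>.  It agrees almost surely with a
countable supremum of members of the family, so that completeness yields the stronger
measurability.\<close>

lemma is_ess_sup_F_at_measurable:
  assumes \<tau>: "\<tau> \<in> \<Theta>" and X: "X \<subseteq> borel_measurable (F_at M F \<tau>)" and g: "is_ess_sup M X g"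
  shows "g \<in> borel_measurable (F_at M F \<tau>)"
proof -
  have "X \<subseteq> borel_measurable M"
  proof
    fix f assume "f \<in> X"
    then have "f \<in> borel_measurable (F_at M F \<tau>)"
      using X by (rule subsetD[rotated])
    with \<tau> show "f \<in> borel_measurable M"
      by (rule F_at_measurable_imp)
  qed
  then obtain C where C: "countable C" "C \<subseteq> X" "is_ess_sup M X (\<lambda>\<omega>. SUP f\<in>C. f \<omega>)"
    by (rule ess_sup_countable)
  show ?thesis
  proof (rule measurable_F_at_AE_cong[OF \<tau>])
    show "(\<lambda>\<omega>. SUP f\<in>C. f \<omega>) \<in> borel_measurable (F_at M F \<tau>)"
      by (intro borel_measurable_SUP C(1) subsetD[OF X] subsetD[OF C(2)])
    show "AE \<omega> in M. (SUP f\<in>C. f \<omega>) = g \<omega>"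
      using C(3) g by (rule is_ess_sup_unique)
  qed
qed

lemma is_ess_sup_LpF:
  assumes S: "S \<in> \<Theta>" and X: "X \<subseteq> (\<lambda>f \<omega>. ereal (f \<omega>)) ` LpF p S"
  shows "is_ess_sup M X (ess_sup M X)" "ess_sup M X \<in> borel_measurable (F_at M F S)"
proof -
  have F: "f \<in> borel_measurable (F_at M F S)" if f: "f \<in> X" for f
  proof -
    obtain g where g: "f = (\<lambda>\<omega>. ereal (g \<omega>))" "g \<in> LpF p S"
      using subsetD[OF X f] by (rule imageE)
    have "g \<in> borel_measurable (F_at M F S)"
      using g(2) S by (rule LpFD(1))
    then show ?thesis
      unfolding g(1) by (rule borel_measurable_ereal)
  qed
  have "f \<in> borel_measurable M" if "f \<in> X" for f
    using S F[OF that] by (rule F_at_measurable_imp)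
  then show ess: "is_ess_sup M X (ess_sup M X)"
    by (intro is_ess_sup_ess_sup subsetI)
  show "ess_sup M X \<in> borel_measurable (F_at M F S)"
    by (rule is_ess_sup_F_at_measurable[OF S subsetI[OF F] ess])
qed

end

lemma is_ess_sup_upper: "is_ess_sup M X g \<Longrightarrow> f \<in> X \<Longrightarrow> AE \<omega> in M. f \<omega> \<le> g \<omega>"
  by (simp add: is_ess_sup_def)

lemma is_ess_sup_least:
  "is_ess_sup M X g \<Longrightarrow> h \<in> borel_measurable M \<Longrightarrow> (\<And>f. f \<in> X \<Longrightarrow> AE \<omega> in M. f \<omega> \<le> h \<omega>) \<Longrightarrow>
    AE \<omega> in M. g \<omega> \<le> h \<omega>"
  by (simp add: is_ess_sup_def)

section \<open>Operators and almost sure equality\<close>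

context bermudan_operators
begin

lemma \<rho>_AE_cong:
  assumes "S \<in> \<Theta>" "\<tau> \<in> \<Theta>" "\<eta>1 \<in> LpF p \<tau>" "\<eta>2 \<in> LpF p \<tau>" "AE \<omega> in M. \<eta>1 \<omega> = \<eta>2 \<omega>"
  shows "AE \<omega> in M. \<rho> S \<tau> \<eta>1 \<omega> = \<rho> S \<tau> \<eta>2 \<omega>"
proof -
  have "AE \<omega> in M. \<eta>1 \<omega> \<le> \<eta>2 \<omega>" "AE \<omega> in M. \<eta>2 \<omega> \<le> \<eta>1 \<omega>"
    using assms(5) by (eventually_elim, simp)+
  then have "AE \<omega> in M. \<rho> S \<tau> \<eta>1 \<omega> \<le> \<rho> S \<tau> \<eta>2 \<omega>" "AE \<omega> in M. \<rho> S \<tau> \<eta>2 \<omega> \<le> \<rho> S \<tau> \<eta>1 \<omega>"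
    by - (intro monotonicity assms(1-4), assumption)+
  then show ?thesis
    by eventually_elim simp
qed

text \<open>Evaluating at \<open>\<tau>\<close> a payoff from the almost surely equal time \<open>\<tau>'\<close> changes nothing, by knowledge
preservation; consistency carries this over to the evaluation at \<open>S\<close>.\<close>

lemma \<rho>_AE_cong_time:
  assumes S: "S \<in> \<Theta>" and \<tau>: "\<tau> \<in> \<Theta>_from S" and \<tau>': "\<tau>' \<in> \<Theta>"
    and eq: "AE \<omega> in M. \<tau> \<omega> = \<tau>' \<omega>" and \<eta>: "\<eta> \<in> LpF p \<tau>"
  shows "AE \<omega> in M. \<rho> S \<tau> \<eta> \<omega> = \<rho> S \<tau>' \<eta> \<omega>"
proof -
  have \<tau>_in: "\<tau> \<in> \<Theta>"
    using \<tau> by (simp add: times_from_def)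
  have le: "AE \<omega> in M. \<tau> \<omega> \<le> \<tau>' \<omega>" "AE \<omega> in M. \<tau>' \<omega> \<le> \<tau> \<omega>"
    using eq by (eventually_elim, simp)+
  have mutual: "\<tau>' \<in> \<Theta>_from \<tau>" "\<tau> \<in> \<Theta>_from \<tau>'"
    using le \<tau>' \<tau>_in by (simp_all add: times_from_def)
  have \<eta>': "\<eta> \<in> LpF p \<tau>'"
    using LpF_AE_mono[OF \<tau>_in \<tau>' le(1) \<eta>] .
  have "AE \<omega> in M. \<rho> \<tau> \<tau>' \<eta> \<omega> = \<eta> \<omega>"
    using \<tau>' mutual(2) \<eta>' by (rule knowledge_preservation)
  then have "AE \<omega> in M. \<rho> S \<tau> (\<rho> \<tau> \<tau>' \<eta>) \<omega> = \<rho> S \<tau> \<eta> \<omega>"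
    by (intro \<rho>_AE_cong S \<tau>_in \<eta> \<rho>_Lp \<tau>' \<eta>')
  moreover have "AE \<omega> in M. \<rho> S \<tau> (\<rho> \<tau> \<tau>' \<eta>) \<omega> = \<rho> S \<tau>' \<eta> \<omega>"
    using S \<tau> mutual(1) \<eta>' by (rule consistency)
  ultimately show ?thesis
    by eventually_elim simp
qed

text \<open>The generalized zero-one law for a family \<open>\<zeta>\<close> that is adapted only at times after \<open>\<sigma>\<close>, such as
\<open>\<tau> \<mapsto> \<psi> \<sigma> \<tau>\<close>.  Setting the family to zero where \<open>\<tau> < \<sigma>\<close> makes it admissible and, up to null
sets, does not change it at the times after \<open>\<sigma>\<close>.\<close>

lemma zero_one_from:
  assumes \<sigma>: "\<sigma> \<in> \<Theta>" and A: "A \<in> sets (F_at M F \<sigma>)"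
    and \<nu>: "\<nu> \<in> \<Theta>_from \<sigma>" and \<nu>': "\<nu>' \<in> \<Theta>_from \<sigma>" and eq: "AE \<omega> in M. \<omega> \<in> A \<longrightarrow> \<nu> \<omega> = \<nu>' \<omega>"
    and \<zeta>_Lp: "\<And>\<tau>. \<tau> \<in> \<Theta>_from \<sigma> \<Longrightarrow> \<zeta> \<tau> \<in> LpF p \<tau>"
    and \<zeta>_local: "\<And>\<tau> \<tau>'. \<tau> \<in> \<Theta> \<Longrightarrow> \<tau>' \<in> \<Theta> \<Longrightarrow> AE \<omega> in M. \<tau> \<omega> = \<tau>' \<omega> \<longrightarrow> \<zeta> \<tau> \<omega> = \<zeta> \<tau>' \<omega>"
  shows "AE \<omega> in M. \<omega> \<in> A \<longrightarrow> \<rho> \<sigma> \<nu> (\<zeta> \<nu>) \<omega> = \<rho> \<sigma> \<nu>' (\<zeta> \<nu>') \<omega>"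
proof -
  \<comment> \<open>The condition \<open>max \<tau> \<sigma> \<le> \<tau>\<close> says \<open>\<sigma> \<le> \<tau>\<close>, in the form needed to transfer measurability.\<close>
  define \<xi> where "\<xi> \<tau> \<omega> = (if rv_max \<tau> \<sigma> \<omega> \<le> \<tau> \<omega> then \<zeta> (rv_max \<tau> \<sigma>) \<omega> else 0)" for \<tau> \<omega>
  have mx: "rv_max \<tau> \<sigma> \<in> \<Theta>_from \<sigma>" "rv_max \<tau> \<sigma> \<in> \<Theta>" if "\<tau> \<in> \<Theta>" for \<tau>
    using rv_max_bermudan[OF that \<sigma>] by (simp_all add: times_from_def)
  have \<xi>_meas: "\<xi> \<tau> \<in> borel_measurable (F_at M F \<tau>)" if \<tau>: "\<tau> \<in> \<Theta>" for \<tau>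
  proof -
    have "\<zeta> (rv_max \<tau> \<sigma>) \<in> borel_measurable (F_at M F (rv_max \<tau> \<sigma>))"
      using \<zeta>_Lp[OF mx(1)[OF \<tau>]] mx(2)[OF \<tau>] by (rule LpFD(1))
    then show ?thesis
      unfolding \<xi>_def[abs_def]
      by (intro measurable_pre_sigma_transfer bermudan_timesD(1) mx(2) \<tau>)
  qed
  have \<xi>_Lp: "\<xi> \<tau> \<in> LpF p \<tau>" if \<tau>: "\<tau> \<in> \<Theta>" for \<tau>
  proof -
    have "\<zeta> (rv_max \<tau> \<sigma>) \<in> Lp p M M"
      using \<zeta>_Lp[OF mx(1)[OF \<tau>]] mx(2)[OF \<tau>] by (rule LpFD(2))
    then have "\<xi> \<tau> \<in> Lp p M M"
      by (rule Lp_dominated) (use F_at_measurable_imp[OF \<tau> \<xi>_meas[OF \<tau>]] in \<open>simp_all add: \<xi>_def\<close>)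
    with \<tau> \<xi>_meas[OF \<tau>] show ?thesis
      by (rule LpFI)
  qed
  have adm: "admissible M F \<Theta> \<xi>"
    unfolding admissible_def
  proof (intro conjI ballI \<xi>_meas)
    fix \<tau> \<tau>' assume "\<tau> \<in> \<Theta>" "\<tau>' \<in> \<Theta>"
    then have "AE \<omega> in M. rv_max \<tau> \<sigma> \<omega> = rv_max \<tau>' \<sigma> \<omega> \<longrightarrow> \<zeta> (rv_max \<tau> \<sigma>) \<omega> = \<zeta> (rv_max \<tau>' \<sigma>) \<omega>"
      by (intro \<zeta>_local mx(2))
    then show "AE \<omega> in M. \<tau> \<omega> = \<tau>' \<omega> \<longrightarrow> \<xi> \<tau> \<omega> = \<xi> \<tau>' \<omega>"
      by eventually_elim (simp add: \<xi>_def)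
  qed
  have int: "p_integrable M p \<Theta> \<xi>"
    unfolding p_integrable_def by (intro ballI LpFD(2)[OF \<xi>_Lp])
  have \<xi>\<zeta>: "AE \<omega> in M. \<rho> \<sigma> \<tau> (\<xi> \<tau>) \<omega> = \<rho> \<sigma> \<tau> (\<zeta> \<tau>) \<omega>" if \<tau>: "\<tau> \<in> \<Theta>_from \<sigma>" for \<tau>
  proof (rule \<rho>_AE_cong[OF \<sigma>])
    show \<tau>_in: "\<tau> \<in> \<Theta>"
      using \<tau> by (simp add: times_from_def)
    show "\<xi> \<tau> \<in> LpF p \<tau>" "\<zeta> \<tau> \<in> LpF p \<tau>"
      using \<xi>_Lp[OF \<tau>_in] \<zeta>_Lp[OF \<tau>] .
    have "AE \<omega> in M. \<sigma> \<omega> \<le> \<tau> \<omega>"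
      using \<tau> by (simp add: times_from_def)
    then show "AE \<omega> in M. \<xi> \<tau> \<omega> = \<zeta> \<tau> \<omega>"
      using \<zeta>_local[OF mx(2)[OF \<tau>_in] \<tau>_in] by eventually_elim (simp add: \<xi>_def)
  qed
  have "AE \<omega> in M. indicator A \<omega> * \<rho> \<sigma> \<nu> (\<xi> \<nu>) \<omega> = indicator A \<omega> * \<rho> \<sigma> \<nu>' (\<xi> \<nu>') \<omega>"
    using adm int \<sigma> A \<nu> \<nu>' eq by (rule zero_one)
  then show ?thesis
    using \<xi>\<zeta>[OF \<nu>] \<xi>\<zeta>[OF \<nu>'] by eventually_elim auto
qed

end

section \<open>The value families of the double stopping problem\<close>

locale double_stopping = bermudan_operators M F T \<theta> p \<rho>
  for M :: "'a measure" and F T \<theta> p \<rho> +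
  fixes \<psi> :: "('a \<Rightarrow> real) \<Rightarrow> ('a \<Rightarrow> real) \<Rightarrow> 'a \<Rightarrow> real"
  assumes bi_adm: "bi_admissible M F \<Theta> \<psi>"
    and bi_int: "bi_p_integrable M p \<Theta> \<psi>"
    and V_finite: "\<And>R. R \<in> \<Theta> \<Longrightarrow> AE \<omega> in M. \<bar>value_V M \<Theta> \<rho> \<psi> R \<omega>\<bar> \<noteq> \<infinity>"
    and V_Lp: "\<And>R. R \<in> \<Theta> \<Longrightarrow> (\<lambda>\<omega>. real_of_ereal (value_V M \<Theta> \<rho> \<psi> R \<omega>)) \<in> Lp p M M"
begin

abbreviation "V \<equiv> value_V M \<Theta> \<rho> \<psi>"
abbreviation "v1 \<equiv> value_v1 M \<Theta> \<rho> \<psi>"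
abbreviation "v2 \<equiv> value_v2 M \<Theta> \<rho> \<psi>"
abbreviation "\<phi> \<equiv> reward_phi M \<Theta> \<rho> \<psi>"
abbreviation "\<phi>\<^sub>r \<tau> \<equiv> (\<lambda>\<omega>. real_of_ereal (\<phi> \<tau> \<omega>))"
abbreviation "u \<equiv> value_u M \<Theta> \<rho> \<psi>"

lemma psi_LpF_max:
  assumes \<tau>: "\<tau>1 \<in> \<Theta>" "\<tau>2 \<in> \<Theta>"
  shows "\<psi> \<tau>1 \<tau>2 \<in> LpF p (rv_max \<tau>1 \<tau>2)"
  unfolding LpF_iff[OF rv_max_bermudan[OF \<tau>]]
proof
  show "\<psi> \<tau>1 \<tau>2 \<in> borel_measurable (F_at M F (rv_max \<tau>1 \<tau>2))"
    by (rule bi_adm[unfolded bi_admissible_def, THEN conjunct1, rule_format, OF \<tau>])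
  show "\<psi> \<tau>1 \<tau>2 \<in> Lp p M M"
    by (rule bi_int[unfolded bi_p_integrable_def, rule_format, OF \<tau>])
qed

lemma psi_LpF:
  assumes \<tau>: "\<tau>1 \<in> \<Theta>" "\<tau>2 \<in> \<Theta>" "\<nu> \<in> \<Theta>"
    and le: "AE \<omega> in M. \<tau>1 \<omega> \<le> \<nu> \<omega>" "AE \<omega> in M. \<tau>2 \<omega> \<le> \<nu> \<omega>"
  shows "\<psi> \<tau>1 \<tau>2 \<in> LpF p \<nu>"
proof (rule LpF_AE_mono[OF _ \<tau>(3) _ psi_LpF_max[OF \<tau>(1,2)]])
  show "rv_max \<tau>1 \<tau>2 \<in> \<Theta>"
    using \<tau>(1,2) by (rule rv_max_bermudan)
  show "AE \<omega> in M. rv_max \<tau>1 \<tau>2 \<omega> \<le> \<nu> \<omega>"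
    using le by eventually_elim simp
qed

lemma psi_local:
  assumes "\<tau>1 \<in> \<Theta>" "\<tau>2 \<in> \<Theta>" "\<sigma>1 \<in> \<Theta>" "\<sigma>2 \<in> \<Theta>"
  shows "AE \<omega> in M. \<tau>1 \<omega> = \<sigma>1 \<omega> \<and> \<tau>2 \<omega> = \<sigma>2 \<omega> \<longrightarrow> \<psi> \<tau>1 \<tau>2 \<omega> = \<psi> \<sigma>1 \<sigma>2 \<omega>"
  by (rule bi_adm[unfolded bi_admissible_def, THEN conjunct2, rule_format, OF assms])

lemma psi_from_LpF:
  assumes \<sigma>: "\<sigma> \<in> \<Theta>" and \<tau>: "\<tau> \<in> \<Theta>_from \<sigma>"
  shows "\<psi> \<sigma> \<tau> \<in> LpF p \<tau>" "\<psi> \<tau> \<sigma> \<in> LpF p \<tau>"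
proof -
  have "\<tau> \<in> \<Theta>" "AE \<omega> in M. \<sigma> \<omega> \<le> \<tau> \<omega>"
    using \<tau> by (simp_all add: times_from_def)
  then show "\<psi> \<sigma> \<tau> \<in> LpF p \<tau>" "\<psi> \<tau> \<sigma> \<in> LpF p \<tau>"
    using \<sigma> by (simp_all add: psi_LpF)
qed

lemma is_ess_sup_V:
  assumes "S \<in> \<Theta>"
  shows "is_ess_sup M ((\<lambda>(\<tau>1, \<tau>2) \<omega>. ereal (\<rho> S (rv_max \<tau>1 \<tau>2) (\<psi> \<tau>1 \<tau>2) \<omega>))
    ` (\<Theta>_from S \<times> \<Theta>_from S)) (V S)"
  unfolding value_V_def
proof (rule is_ess_sup_LpF(1)[OF assms], rule subsetI)
  fix f assume "f \<in> (\<lambda>(\<tau>1, \<tau>2) \<omega>. ereal (\<rho> S (rv_max \<tau>1 \<tau>2) (\<psi> \<tau>1 \<tau>2) \<omega>)) ` (\<Theta>_from S \<times> \<Theta>_from S)"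
  then obtain \<tau>1 \<tau>2 where f: "f = (\<lambda>\<omega>. ereal (\<rho> S (rv_max \<tau>1 \<tau>2) (\<psi> \<tau>1 \<tau>2) \<omega>))"
    and \<tau>: "\<tau>1 \<in> \<Theta>" "\<tau>2 \<in> \<Theta>"
    by (force simp: times_from_def)
  have "\<rho> S (rv_max \<tau>1 \<tau>2) (\<psi> \<tau>1 \<tau>2) \<in> LpF p S"
    by (intro \<rho>_Lp assms rv_max_bermudan psi_LpF_max \<tau>)
  with f show "f \<in> (\<lambda>f \<omega>. ereal (f \<omega>)) ` LpF p S"
    by (rule image_eqI)
qed

lemma v1_ess_sup:
  assumes "S \<in> \<Theta>"
  shows "is_ess_sup M ((\<lambda>\<tau>1 \<omega>. ereal (\<rho> S \<tau>1 (\<psi> \<tau>1 S) \<omega>)) ` \<Theta>_from S) (v1 S)"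
    and "v1 S \<in> borel_measurable (F_at M F S)"
proof -
  have "(\<lambda>\<tau>1 \<omega>. ereal (\<rho> S \<tau>1 (\<psi> \<tau>1 S) \<omega>)) ` \<Theta>_from S \<subseteq> (\<lambda>f \<omega>. ereal (f \<omega>)) ` LpF p S"
  proof (rule image_subsetI)
    fix \<tau> assume \<tau>: "\<tau> \<in> \<Theta>_from S"
    then have "\<rho> S \<tau> (\<psi> \<tau> S) \<in> LpF p S"
      by (intro \<rho>_Lp assms psi_from_LpF) (simp_all add: times_from_def)
    then show "(\<lambda>\<omega>. ereal (\<rho> S \<tau> (\<psi> \<tau> S) \<omega>)) \<in> (\<lambda>f \<omega>. ereal (f \<omega>)) ` LpF p S"
      by (rule image_eqI[OF refl])
  qed
  from is_ess_sup_LpF[OF assms this]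
  show "is_ess_sup M ((\<lambda>\<tau>1 \<omega>. ereal (\<rho> S \<tau>1 (\<psi> \<tau>1 S) \<omega>)) ` \<Theta>_from S) (v1 S)"
    and "v1 S \<in> borel_measurable (F_at M F S)"
    unfolding value_v1_def by blast+
qed

lemma v2_ess_sup:
  assumes "S \<in> \<Theta>"
  shows "is_ess_sup M ((\<lambda>\<tau>2 \<omega>. ereal (\<rho> S \<tau>2 (\<psi> S \<tau>2) \<omega>)) ` \<Theta>_from S) (v2 S)"
    and "v2 S \<in> borel_measurable (F_at M F S)"
proof -
  have "(\<lambda>\<tau>2 \<omega>. ereal (\<rho> S \<tau>2 (\<psi> S \<tau>2) \<omega>)) ` \<Theta>_from S \<subseteq> (\<lambda>f \<omega>. ereal (f \<omega>)) ` LpF p S"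
  proof (rule image_subsetI)
    fix \<tau> assume \<tau>: "\<tau> \<in> \<Theta>_from S"
    then have "\<rho> S \<tau> (\<psi> S \<tau>) \<in> LpF p S"
      by (intro \<rho>_Lp assms psi_from_LpF) (simp_all add: times_from_def)
    then show "(\<lambda>\<omega>. ereal (\<rho> S \<tau> (\<psi> S \<tau>) \<omega>)) \<in> (\<lambda>f \<omega>. ereal (f \<omega>)) ` LpF p S"
      by (rule image_eqI[OF refl])
  qed
  from is_ess_sup_LpF[OF assms this]
  show "is_ess_sup M ((\<lambda>\<tau>2 \<omega>. ereal (\<rho> S \<tau>2 (\<psi> S \<tau>2) \<omega>)) ` \<Theta>_from S) (v2 S)"
    and "v2 S \<in> borel_measurable (F_at M F S)"
    unfolding value_v2_def by blast+
qed

lemma le_V: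
  assumes "S \<in> \<Theta>" "\<tau>1 \<in> \<Theta>_from S" "\<tau>2 \<in> \<Theta>_from S"
  shows "AE \<omega> in M. ereal (\<rho> S (rv_max \<tau>1 \<tau>2) (\<psi> \<tau>1 \<tau>2) \<omega>) \<le> V S \<omega>"
  using is_ess_sup_upper[OF is_ess_sup_V[OF assms(1)]] assms(2,3) by force

lemma le_v1:
  assumes "S \<in> \<Theta>" "\<tau> \<in> \<Theta>_from S"
  shows "AE \<omega> in M. ereal (\<rho> S \<tau> (\<psi> \<tau> S) \<omega>) \<le> v1 S \<omega>"
  using is_ess_sup_upper[OF v1_ess_sup(1)[OF assms(1)]] assms(2) by blast

lemma le_v2:
  assumes "S \<in> \<Theta>" "\<tau> \<in> \<Theta>_from S"
  shows "AE \<omega> in M. ereal (\<rho> S \<tau> (\<psi> S \<tau>) \<omega>) \<le> v2 S \<omega>"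
  using is_ess_sup_upper[OF v2_ess_sup(1)[OF assms(1)]] assms(2) by blast

lemma V_measurable: "S \<in> \<Theta> \<Longrightarrow> V S \<in> borel_measurable M"
  using is_ess_sup_V by (simp add: is_ess_sup_def)

text \<open>The problems \<open>v1 S\<close> and \<open>v2 S\<close> are \<open>V S\<close> with one of the two times fixed to be \<open>S\<close>.  The operators in
\<open>V S\<close> evaluate at \<open>max \<tau> S\<close>, which agrees with \<open>\<tau>\<close> only almost surely.\<close>

lemma phi_le_V:
  assumes S: "S \<in> \<Theta>"
  shows "AE \<omega> in M. \<phi> S \<omega> \<le> V S \<omega>"
proof -
  have "AE \<omega> in M. v1 S \<omega> \<le> V S \<omega>"
  proof (rule is_ess_sup_least[OF v1_ess_sup(1)[OF S] V_measurable[OF S]])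
    fix f assume "f \<in> (\<lambda>\<tau>1 \<omega>. ereal (\<rho> S \<tau>1 (\<psi> \<tau>1 S) \<omega>)) ` \<Theta>_from S"
    then obtain \<tau> where f: "f = (\<lambda>\<omega>. ereal (\<rho> S \<tau> (\<psi> \<tau> S) \<omega>))" and \<tau>: "\<tau> \<in> \<Theta>_from S"
      by blast
    have \<tau>_in: "\<tau> \<in> \<Theta>" and le: "AE \<omega> in M. S \<omega> \<le> \<tau> \<omega>"
      using \<tau> by (simp_all add: times_from_def)
    have "AE \<omega> in M. \<rho> S \<tau> (\<psi> \<tau> S) \<omega> = \<rho> S (rv_max \<tau> S) (\<psi> \<tau> S) \<omega>"
      by (intro \<rho>_AE_cong_time S \<tau> rv_max_bermudan \<tau>_in psi_from_LpF)
        (use le in \<open>eventually_elim, simp\<close>)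
    then show "AE \<omega> in M. f \<omega> \<le> V S \<omega>"
      using le_V[OF S \<tau> times_from_self[OF S]] by eventually_elim (simp add: f)
  qed
  moreover have "AE \<omega> in M. v2 S \<omega> \<le> V S \<omega>"
  proof (rule is_ess_sup_least[OF v2_ess_sup(1)[OF S] V_measurable[OF S]])
    fix f assume "f \<in> (\<lambda>\<tau>2 \<omega>. ereal (\<rho> S \<tau>2 (\<psi> S \<tau>2) \<omega>)) ` \<Theta>_from S"
    then obtain \<tau> where f: "f = (\<lambda>\<omega>. ereal (\<rho> S \<tau> (\<psi> S \<tau>) \<omega>))" and \<tau>: "\<tau> \<in> \<Theta>_from S"
      by blast
    have \<tau>_in: "\<tau> \<in> \<Theta>" and le: "AE \<omega> in M. S \<omega> \<le> \<tau> \<omega>"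
      using \<tau> by (simp_all add: times_from_def)
    have "AE \<omega> in M. \<rho> S \<tau> (\<psi> S \<tau>) \<omega> = \<rho> S (rv_max S \<tau>) (\<psi> S \<tau>) \<omega>"
      by (intro \<rho>_AE_cong_time S \<tau> rv_max_bermudan \<tau>_in psi_from_LpF)
        (use le in \<open>eventually_elim, simp\<close>)
    then show "AE \<omega> in M. f \<omega> \<le> V S \<omega>"
      using le_V[OF S times_from_self[OF S] \<tau>] by eventually_elim (simp add: f)
  qed
  ultimately show ?thesis
    by eventually_elim (simp add: reward_phi_def)
qed

text \<open>Stopping both times at \<open>S\<close> is allowed in \<open>v2 S\<close>, so \<open>\<phi> S\<close> lies between the real payoff
\<open>\<rho> S S (\<psi> S S)\<close> and \<open>V S\<close>.\<close>

lemma phi_finite_LpF: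
  assumes S: "S \<in> \<Theta>"
  shows "AE \<omega> in M. \<phi> S \<omega> = ereal (\<phi>\<^sub>r S \<omega>)" and "\<phi>\<^sub>r S \<in> LpF p S"
proof -
  have low: "AE \<omega> in M. ereal (\<rho> S S (\<psi> S S) \<omega>) \<le> \<phi> S \<omega>"
    using le_v2[OF S times_from_self[OF S]] by eventually_elim (simp add: reward_phi_def le_max_iff_disj)
  show fin: "AE \<omega> in M. \<phi> S \<omega> = ereal (\<phi>\<^sub>r S \<omega>)"
    using low phi_le_V[OF S] V_finite[OF S]
  proof eventually_elim
    case (elim \<omega>)
    then show ?case
      by (cases "\<phi> S \<omega>"; cases "V S \<omega>") simp_all
  qed
  have meas: "\<phi>\<^sub>r S \<in> borel_measurable (F_at M F S)"
    unfolding reward_phi_def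
    by (intro borel_measurable_real_of_ereal borel_measurable_max v1_ess_sup(2) v2_ess_sup(2) S)
  have "\<rho> S S (\<psi> S S) \<in> LpF p S"
    by (intro \<rho>_Lp psi_from_LpF S times_from_self)
  then have "\<rho> S S (\<psi> S S) \<in> Lp p M M"
    using S by (rule LpFD(2))
  then have "\<phi>\<^sub>r S \<in> Lp p M M"
  proof (rule Lp_sandwich[OF _ V_Lp[OF S]])
    show "\<phi>\<^sub>r S \<in> borel_measurable M"
      using S meas by (rule F_at_measurable_imp)
    show "AE \<omega> in M. \<rho> S S (\<psi> S S) \<omega> \<le> \<phi>\<^sub>r S \<omega>"
      using low fin by eventually_elim (metis ereal_less_eq(3))
    show "AE \<omega> in M. \<phi>\<^sub>r S \<omega> \<le> real_of_ereal (V S \<omega>)"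
      using fin phi_le_V[OF S] V_finite[OF S]
    proof eventually_elim
      case (elim \<omega>)
      then show ?case
        by (cases "\<phi> S \<omega>"; cases "V S \<omega>") simp_all
    qed
  qed
  with S meas show "\<phi>\<^sub>r S \<in> LpF p S"
    by (rule LpFI)
qed

lemma u_ess_sup:
  assumes S: "S \<in> \<Theta>"
  shows "is_ess_sup M ((\<lambda>\<tau> \<omega>. ereal (\<rho> S \<tau> (\<phi>\<^sub>r \<tau>) \<omega>)) ` \<Theta>_from S) (u S)"
  unfolding value_u_def
proof (rule is_ess_sup_LpF(1)[OF S], rule image_subsetI)
  fix \<tau> assume \<tau>: "\<tau> \<in> \<Theta>_from S"
  then have "\<rho> S \<tau> (\<phi>\<^sub>r \<tau>) \<in> LpF p S"
    by (intro \<rho>_Lp S phi_finite_LpF) (simp_all add: times_from_def)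
  then show "(\<lambda>\<omega>. ereal (\<rho> S \<tau> (\<phi>\<^sub>r \<tau>) \<omega>)) \<in> (\<lambda>f \<omega>. ereal (f \<omega>)) ` LpF p S"
    by (rule image_eqI[OF refl])
qed

lemma le_u:
  assumes "S \<in> \<Theta>" "\<tau> \<in> \<Theta>_from S"
  shows "AE \<omega> in M. ereal (\<rho> S \<tau> (\<phi>\<^sub>r \<tau>) \<omega>) \<le> u S \<omega>"
  using is_ess_sup_upper[OF u_ess_sup[OF assms(1)]] assms(2) by blast

text \<open>These are the two ordered zero-one laws, with the minimum replaced by any almost surely equal time
\<open>\<sigma>\<close>; the generality is needed because the minimum of the optimal pair is the optimal time only up
to a null set.\<close>

lemma \<rho>_psi_min_max:
  assumes \<tau>: "\<tau>1 \<in> \<Theta>" "\<tau>2 \<in> \<Theta>" and \<sigma>: "\<sigma> \<in> \<Theta>" and min: "AE \<omega> in M. rv_min \<tau>1 \<tau>2 \<omega> = \<sigma> \<omega>"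
  shows "AE \<omega> in M. \<tau>1 \<omega> \<le> \<tau>2 \<omega> \<longrightarrow> \<rho> \<sigma> (rv_max \<tau>1 \<tau>2) (\<psi> \<tau>1 \<tau>2) \<omega>
            = \<rho> \<sigma> (rv_max \<tau>1 \<tau>2) (\<psi> \<sigma> (rv_max \<tau>1 \<tau>2)) \<omega>"
    and "AE \<omega> in M. \<tau>1 \<omega> \<le> \<tau>2 \<omega> \<longrightarrow> \<rho> \<sigma> (rv_max \<tau>1 \<tau>2) (\<psi> \<tau>2 \<tau>1) \<omega>
            = \<rho> \<sigma> (rv_max \<tau>1 \<tau>2) (\<psi> (rv_max \<tau>1 \<tau>2) \<sigma>) \<omega>"
proof -
  let ?m = "rv_min \<tau>1 \<tau>2" and ?x = "rv_max \<tau>1 \<tau>2"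
  let ?A = "{\<omega> \<in> space M. \<tau>1 \<omega> \<le> \<tau>2 \<omega>}"
  have m: "?m \<in> \<Theta>" and x: "?x \<in> \<Theta>"
    using \<tau> by (simp_all add: rv_min_bermudan rv_max_bermudan)
  have "?A = {\<omega> \<in> space M. \<tau>1 \<omega> \<le> ?m \<omega>}"
    by auto
  then have A: "?A \<in> sets (F_at M F ?m)"
    using sets_stopped_leq[OF bermudan_timesD(1)[OF \<tau>(1)] bermudan_timesD(1)[OF m]] by simp
  have A_eq: "AE \<omega> in M. \<omega> \<in> ?A \<longrightarrow> ?m \<omega> = \<tau>1 \<omega> \<and> ?x \<omega> = \<tau>2 \<omega>"
    by (intro AE_I2) auto
  have mx: "?x \<in> \<Theta>_from ?m"
    using x by (simp add: times_from_def)
  have \<sigma>x: "?x \<in> \<Theta>_from \<sigma>"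
  proof -
    have "AE \<omega> in M. \<sigma> \<omega> \<le> ?x \<omega>"
      using min by eventually_elim auto
    with x show ?thesis
      by (simp add: times_from_def)
  qed
  have start: "AE \<omega> in M. \<rho> \<sigma> ?x \<eta> \<omega> = \<rho> ?m ?x \<eta> \<omega>" if "\<eta> \<in> LpF p ?x" for \<eta>
    using admissibility[OF m \<sigma> x that] min by eventually_elim simp
  have Lp: "\<psi> \<tau>1 \<tau>2 \<in> LpF p ?x" "\<psi> \<tau>2 \<tau>1 \<in> LpF p ?x"
    using \<tau> x by (simp_all add: psi_LpF)
  have fst: "AE \<omega> in M. \<rho> ?m ?x (\<psi> ?m ?x) \<omega> = \<rho> ?m ?x (\<psi> \<sigma> ?x) \<omega>"
  proof (rule \<rho>_AE_cong[OF m x psi_from_LpF(1)[OF m mx] psi_from_LpF(1)[OF \<sigma> \<sigma>x]])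
    show "AE \<omega> in M. \<psi> ?m ?x \<omega> = \<psi> \<sigma> ?x \<omega>"
      using psi_local[OF m x \<sigma> x] min by eventually_elim simp
  qed
  have snd: "AE \<omega> in M. \<rho> ?m ?x (\<psi> ?x ?m) \<omega> = \<rho> ?m ?x (\<psi> ?x \<sigma>) \<omega>"
  proof (rule \<rho>_AE_cong[OF m x psi_from_LpF(2)[OF m mx] psi_from_LpF(2)[OF \<sigma> \<sigma>x]])
    show "AE \<omega> in M. \<psi> ?x ?m \<omega> = \<psi> ?x \<sigma> \<omega>"
      using psi_local[OF x m x \<sigma>] min by eventually_elim simp
  qed
  show "AE \<omega> in M. \<tau>1 \<omega> \<le> \<tau>2 \<omega> \<longrightarrow> \<rho> \<sigma> ?x (\<psi> \<tau>1 \<tau>2) \<omega> = \<rho> \<sigma> ?x (\<psi> \<sigma> ?x) \<omega>"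
    using zero_one_ter_fst[OF bi_adm bi_int \<tau> A A_eq] start[OF Lp(1)]
      start[OF psi_from_LpF(1)[OF \<sigma> \<sigma>x]] fst AE_space
    by eventually_elim (auto simp: indicator_def)
  show "AE \<omega> in M. \<tau>1 \<omega> \<le> \<tau>2 \<omega> \<longrightarrow> \<rho> \<sigma> ?x (\<psi> \<tau>2 \<tau>1) \<omega> = \<rho> \<sigma> ?x (\<psi> ?x \<sigma>) \<omega>"
    using zero_one_ter_snd[OF bi_adm bi_int \<tau> A A_eq] start[OF Lp(2)]
      start[OF psi_from_LpF(2)[OF \<sigma> \<sigma>x]] snd AE_space
    by eventually_elim (auto simp: indicator_def)
qed

text \<open>Every pair is dominated by stopping at its minimum and collecting \<open>\<phi>\<close> there.\<close>

lemma V_le_u: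
  assumes S: "S \<in> \<Theta>"
  shows "AE \<omega> in M. V S \<omega> \<le> u S \<omega>"
proof (rule is_ess_sup_least[OF is_ess_sup_V[OF S]])
  show "u S \<in> borel_measurable M"
    using u_ess_sup[OF S] by (simp add: is_ess_sup_def)
next
  fix f assume "f \<in> (\<lambda>(\<tau>1, \<tau>2) \<omega>. ereal (\<rho> S (rv_max \<tau>1 \<tau>2) (\<psi> \<tau>1 \<tau>2) \<omega>)) ` (\<Theta>_from S \<times> \<Theta>_from S)"
  then obtain \<tau>1 \<tau>2 where f: "f = (\<lambda>\<omega>. ereal (\<rho> S (rv_max \<tau>1 \<tau>2) (\<psi> \<tau>1 \<tau>2) \<omega>))"
    and \<tau>_from: "\<tau>1 \<in> \<Theta>_from S" "\<tau>2 \<in> \<Theta>_from S"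
    by auto
  let ?m = "rv_min \<tau>1 \<tau>2" and ?x = "rv_max \<tau>1 \<tau>2"
  have \<tau>: "\<tau>1 \<in> \<Theta>" "\<tau>2 \<in> \<Theta>" and le: "AE \<omega> in M. S \<omega> \<le> \<tau>1 \<omega>" "AE \<omega> in M. S \<omega> \<le> \<tau>2 \<omega>"
    using \<tau>_from by (simp_all add: times_from_def)
  have m: "?m \<in> \<Theta>" and x: "?x \<in> \<Theta>"
    using \<tau> by (simp_all add: rv_min_bermudan rv_max_bermudan)
  have "AE \<omega> in M. S \<omega> \<le> ?m \<omega>"
    using le by eventually_elim simp
  with m have Sm: "?m \<in> \<Theta>_from S"
    by (simp add: times_from_def)
  have mx: "?x \<in> \<Theta>_from ?m"
    using x by (simp add: times_from_def)
  have Lp: "\<psi> \<tau>1 \<tau>2 \<in> LpF p ?x"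
    using \<tau> by (rule psi_LpF_max)
  have "AE \<omega> in M. \<tau>1 \<omega> \<le> \<tau>2 \<omega> \<longrightarrow> \<rho> ?m ?x (\<psi> \<tau>1 \<tau>2) \<omega> = \<rho> ?m ?x (\<psi> ?m ?x) \<omega>"
    by (rule \<rho>_psi_min_max(1)[OF \<tau> m]) simp
  moreover have "AE \<omega> in M. \<tau>2 \<omega> \<le> \<tau>1 \<omega> \<longrightarrow> \<rho> ?m ?x (\<psi> \<tau>1 \<tau>2) \<omega> = \<rho> ?m ?x (\<psi> ?x ?m) \<omega>"
    by (rule \<rho>_psi_min_max(2)[OF \<tau>(2,1) m, unfolded rv_max_commute[of \<tau>2 \<tau>1]])
      (simp add: min.commute)
  ultimately have "AE \<omega> in M. \<rho> ?m ?x (\<psi> \<tau>1 \<tau>2) \<omega> \<le> \<phi>\<^sub>r ?m \<omega>"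
    using le_v1[OF m mx] le_v2[OF m mx] phi_finite_LpF(1)[OF m]
  proof eventually_elim
    case (elim \<omega>)
    have "ereal (\<rho> ?m ?x (\<psi> \<tau>1 \<tau>2) \<omega>) \<le> \<phi> ?m \<omega>"
    proof (cases "\<tau>1 \<omega> \<le> \<tau>2 \<omega>")
      case True
      then show ?thesis
        using elim(1,4) by (simp add: reward_phi_def le_max_iff_disj)
    next
      case False
      then show ?thesis
        using elim(2,3) by (simp add: reward_phi_def le_max_iff_disj)
    qed
    then show ?case
      using elim(5) by (metis ereal_less_eq(3))
  qed
  then have "AE \<omega> in M. \<rho> S ?m (\<rho> ?m ?x (\<psi> \<tau>1 \<tau>2)) \<omega> \<le> \<rho> S ?m (\<phi>\<^sub>r ?m) \<omega>"
    by (intro monotonicity S m \<rho>_Lp x Lp phi_finite_LpF(2))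
  moreover have "AE \<omega> in M. \<rho> S ?m (\<rho> ?m ?x (\<psi> \<tau>1 \<tau>2)) \<omega> = \<rho> S ?x (\<psi> \<tau>1 \<tau>2) \<omega>"
    using S Sm mx Lp by (rule consistency)
  ultimately show "AE \<omega> in M. f \<omega> \<le> u S \<omega>"
    using le_u[OF S Sm]
  proof eventually_elim
    case (elim \<omega>)
    then show ?case
      unfolding f by (metis ereal_less_eq(3) order_trans)
  qed
qed

end

section \<open>Optimality of the pasted pair\<close>

context double_stopping
begin

text \<open>At \<open>\<sigma>\<close> the pair is worth \<open>\<phi> \<sigma>\<close>: on \<open>B\<close> it is \<open>(\<sigma>, \<nu>2)\<close>, which is worth \<open>v2 \<sigma>\<close>, and
off \<open>B\<close> it is \<open>(\<nu>1, \<sigma>)\<close>, which is worth \<open>v1 \<sigma>\<close>.\<close>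

lemma pasted_pair_value:
  assumes \<sigma>: "\<sigma> \<in> \<Theta>" and \<nu>1: "\<nu>1 \<in> \<Theta>_from \<sigma>" and \<nu>2: "\<nu>2 \<in> \<Theta>_from \<sigma>"
    and v1_opt: "AE \<omega> in M. v1 \<sigma> \<omega> = ereal (\<rho> \<sigma> \<nu>1 (\<psi> \<nu>1 \<sigma>) \<omega>)"
    and v2_opt: "AE \<omega> in M. v2 \<sigma> \<omega> = ereal (\<rho> \<sigma> \<nu>2 (\<psi> \<sigma> \<nu>2) \<omega>)"
    and B: "B = {\<omega> \<in> space M. v1 \<sigma> \<omega> \<le> v2 \<sigma> \<omega>}"
    and \<tau>1: "\<tau>1 = (\<lambda>\<omega>. \<sigma> \<omega> * indicator B \<omega> + \<nu>1 \<omega> * indicator (space M - B) \<omega>)"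
    and \<tau>2: "\<tau>2 = (\<lambda>\<omega>. \<nu>2 \<omega> * indicator B \<omega> + \<sigma> \<omega> * indicator (space M - B) \<omega>)"
  shows "\<tau>1 \<in> \<Theta>_from \<sigma>" "\<tau>2 \<in> \<Theta>_from \<sigma>"
    and "AE \<omega> in M. \<phi>\<^sub>r \<sigma> \<omega> = \<rho> \<sigma> (rv_max \<tau>1 \<tau>2) (\<psi> \<tau>1 \<tau>2) \<omega>"
proof -
  let ?x = "rv_max \<tau>1 \<tau>2"
  have "{\<omega> \<in> space (F_at M F \<sigma>). v1 \<sigma> \<omega> \<le> v2 \<sigma> \<omega>} \<in> sets (F_at M F \<sigma>)"
    by (intro borel_measurable_le v1_ess_sup(2) v2_ess_sup(2) \<sigma>)
  then have B_sets: "B \<in> sets (F_at M F \<sigma>)"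
    by (simp add: B space_pre_sigma)
  then have Bc_sets: "space M - B \<in> sets (F_at M F \<sigma>)"
    using sets.compl_sets[OF B_sets] by (simp add: space_pre_sigma)
  show \<tau>1_from: "\<tau>1 \<in> \<Theta>_from \<sigma>" and \<tau>2_from: "\<tau>2 \<in> \<Theta>_from \<sigma>"
    unfolding \<tau>1 \<tau>2 by (intro bermudan_paste \<sigma> \<nu>1 \<nu>2 times_from_self B_sets)+
  have \<tau>_in: "\<tau>1 \<in> \<Theta>" "\<tau>2 \<in> \<Theta>" and le: "AE \<omega> in M. \<sigma> \<omega> \<le> \<tau>1 \<omega>" "AE \<omega> in M. \<sigma> \<omega> \<le> \<tau>2 \<omega>"
    using \<tau>1_from \<tau>2_from by (simp_all add: times_from_def)
  have x: "?x \<in> \<Theta>"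
    using \<tau>_in by (rule rv_max_bermudan)
  have "AE \<omega> in M. \<sigma> \<omega> \<le> ?x \<omega>"
    using le by eventually_elim auto
  with x have x_from: "?x \<in> \<Theta>_from \<sigma>"
    by (simp add: times_from_def)
  have on_B: "\<tau>1 \<omega> = \<sigma> \<omega>" "\<tau>2 \<omega> = \<nu>2 \<omega>" if "\<omega> \<in> B" for \<omega>
    using that by (simp_all add: \<tau>1 \<tau>2)
  have off_B: "\<tau>1 \<omega> = \<nu>1 \<omega>" "\<tau>2 \<omega> = \<sigma> \<omega>" if "\<omega> \<in> space M - B" for \<omega>
    using that by (simp_all add: \<tau>1 \<tau>2)
  have \<nu>_le: "AE \<omega> in M. \<sigma> \<omega> \<le> \<nu>1 \<omega>" "AE \<omega> in M. \<sigma> \<omega> \<le> \<nu>2 \<omega>"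
    using \<nu>1 \<nu>2 by (simp_all add: times_from_def)
  have min: "AE \<omega> in M. rv_min \<tau>1 \<tau>2 \<omega> = \<sigma> \<omega>"
    using \<nu>_le AE_space
  proof eventually_elim
    case (elim \<omega>)
    then show ?case
      using on_B[of \<omega>] off_B[of \<omega>] by (cases "\<omega> \<in> B") simp_all
  qed
  have "AE \<omega> in M. \<omega> \<in> B \<longrightarrow> ?x \<omega> = \<nu>2 \<omega>"
    using \<nu>_le(2) by eventually_elim (simp add: on_B)
  then have "AE \<omega> in M. \<omega> \<in> B \<longrightarrow> \<rho> \<sigma> ?x (\<psi> \<sigma> ?x) \<omega> = \<rho> \<sigma> \<nu>2 (\<psi> \<sigma> \<nu>2) \<omega>"
  proof (rule zero_one_from[OF \<sigma> B_sets x_from \<nu>2])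
    show "\<psi> \<sigma> \<tau> \<in> LpF p \<tau>" if "\<tau> \<in> \<Theta>_from \<sigma>" for \<tau>
      using \<sigma> that by (rule psi_from_LpF)
    show "AE \<omega> in M. \<tau> \<omega> = \<tau>' \<omega> \<longrightarrow> \<psi> \<sigma> \<tau> \<omega> = \<psi> \<sigma> \<tau>' \<omega>" if "\<tau> \<in> \<Theta>" "\<tau>' \<in> \<Theta>" for \<tau> \<tau>'
      using psi_local[OF \<sigma> that(1) \<sigma> that(2)] by simp
  qed
  moreover have "AE \<omega> in M. \<tau>1 \<omega> \<le> \<tau>2 \<omega> \<longrightarrow> \<rho> \<sigma> ?x (\<psi> \<tau>1 \<tau>2) \<omega> = \<rho> \<sigma> ?x (\<psi> \<sigma> ?x) \<omega>"
    using \<tau>_in \<sigma> min by (rule \<rho>_psi_min_max(1))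
  ultimately have B_value: "AE \<omega> in M. \<omega> \<in> B \<longrightarrow> v2 \<sigma> \<omega> = ereal (\<rho> \<sigma> ?x (\<psi> \<tau>1 \<tau>2) \<omega>)"
    using v2_opt \<nu>_le(2) by eventually_elim (simp add: on_B)
  have "AE \<omega> in M. \<omega> \<in> space M - B \<longrightarrow> ?x \<omega> = \<nu>1 \<omega>"
    using \<nu>_le(1) by eventually_elim (simp add: off_B)
  then have "AE \<omega> in M. \<omega> \<in> space M - B \<longrightarrow> \<rho> \<sigma> ?x (\<psi> ?x \<sigma>) \<omega> = \<rho> \<sigma> \<nu>1 (\<psi> \<nu>1 \<sigma>) \<omega>"
  proof (rule zero_one_from[OF \<sigma> Bc_sets x_from \<nu>1])
    show "\<psi> \<tau> \<sigma> \<in> LpF p \<tau>" if "\<tau> \<in> \<Theta>_from \<sigma>" for \<tau>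
      using \<sigma> that by (rule psi_from_LpF)
    show "AE \<omega> in M. \<tau> \<omega> = \<tau>' \<omega> \<longrightarrow> \<psi> \<tau> \<sigma> \<omega> = \<psi> \<tau>' \<sigma> \<omega>" if "\<tau> \<in> \<Theta>" "\<tau>' \<in> \<Theta>" for \<tau> \<tau>'
      using psi_local[OF that(1) \<sigma> that(2) \<sigma>] by simp
  qed
  moreover have "AE \<omega> in M. \<tau>2 \<omega> \<le> \<tau>1 \<omega> \<longrightarrow> \<rho> \<sigma> ?x (\<psi> \<tau>1 \<tau>2) \<omega> = \<rho> \<sigma> ?x (\<psi> ?x \<sigma>) \<omega>"
    by (rule \<rho>_psi_min_max(2)[OF \<tau>_in(2,1) \<sigma>, unfolded rv_max_commute[of \<tau>2 \<tau>1]])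
      (use min in \<open>simp add: min.commute\<close>)
  ultimately have Bc_value:
      "AE \<omega> in M. \<omega> \<in> space M - B \<longrightarrow> v1 \<sigma> \<omega> = ereal (\<rho> \<sigma> ?x (\<psi> \<tau>1 \<tau>2) \<omega>)"
    using v1_opt \<nu>_le(1) by eventually_elim (simp add: off_B)
  show "AE \<omega> in M. \<phi>\<^sub>r \<sigma> \<omega> = \<rho> \<sigma> ?x (\<psi> \<tau>1 \<tau>2) \<omega>"
    using B_value Bc_value AE_space
  proof eventually_elim
    case (elim \<omega>)
    show ?case
    proof (cases "\<omega> \<in> B")
      case True
      then have "\<phi> \<sigma> \<omega> = v2 \<sigma> \<omega>"
        by (simp add: B reward_phi_def max_def)
      then show ?thesis
        using elim(1) True by simp
    next
      case False
      then have "\<phi> \<sigma> \<omega> = v1 \<sigma> \<omega>"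
        using elim(3) by (simp add: B reward_phi_def max_def)
      then show ?thesis
        using elim(2,3) False by simp
    qed
  qed
qed

text \<open>Consistency turns the value of the pair at \<open>\<sigma>\<close> into its value at \<open>S\<close>, which is therefore \<open>u S\<close>.  Being
at least \<open>V S\<close> by \<open>V_le_u\<close>, and one of the values over which \<open>V S\<close> is the supremum, it equals \<open>V S\<close>.\<close>

lemma pasted_pair_optimal:
  assumes S: "S \<in> \<Theta>" and \<sigma>: "\<sigma> \<in> \<Theta>_from S"
    and u_opt: "AE \<omega> in M. u S \<omega> = ereal (\<rho> S \<sigma> (\<phi>\<^sub>r \<sigma>) \<omega>)"
    and \<tau>: "\<tau>1 \<in> \<Theta>_from \<sigma>" "\<tau>2 \<in> \<Theta>_from \<sigma>"
    and value_eq: "AE \<omega> in M. \<phi>\<^sub>r \<sigma> \<omega> = \<rho> \<sigma> (rv_max \<tau>1 \<tau>2) (\<psi> \<tau>1 \<tau>2) \<omega>"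
  shows "AE \<omega> in M. V S \<omega> = ereal (\<rho> S (rv_max \<tau>1 \<tau>2) (\<psi> \<tau>1 \<tau>2) \<omega>)"
proof -
  let ?x = "rv_max \<tau>1 \<tau>2"
  have \<sigma>_in: "\<sigma> \<in> \<Theta>"
    using \<sigma> by (simp add: times_from_def)
  have \<tau>_in: "\<tau>1 \<in> \<Theta>" "\<tau>2 \<in> \<Theta>" and le: "AE \<omega> in M. \<sigma> \<omega> \<le> \<tau>1 \<omega>"
    using \<tau> by (simp_all add: times_from_def)
  have x: "?x \<in> \<Theta>"
    using \<tau>_in by (rule rv_max_bermudan)
  have "AE \<omega> in M. \<sigma> \<omega> \<le> ?x \<omega>"
    using le by eventually_elim auto
  with x have x_from: "?x \<in> \<Theta>_from \<sigma>"
    by (simp add: times_from_def)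
  have Lp: "\<psi> \<tau>1 \<tau>2 \<in> LpF p ?x"
    using \<tau>_in by (rule psi_LpF_max)
  have "AE \<omega> in M. \<rho> S \<sigma> (\<phi>\<^sub>r \<sigma>) \<omega> = \<rho> S \<sigma> (\<rho> \<sigma> ?x (\<psi> \<tau>1 \<tau>2)) \<omega>"
    by (intro \<rho>_AE_cong S \<sigma>_in phi_finite_LpF(2) \<rho>_Lp x Lp value_eq)
  moreover have "AE \<omega> in M. \<rho> S \<sigma> (\<rho> \<sigma> ?x (\<psi> \<tau>1 \<tau>2)) \<omega> = \<rho> S ?x (\<psi> \<tau>1 \<tau>2) \<omega>"
    using S \<sigma> x_from Lp by (rule consistency)
  ultimately have "AE \<omega> in M. u S \<omega> = ereal (\<rho> S ?x (\<psi> \<tau>1 \<tau>2) \<omega>)"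
    using u_opt by eventually_elim simp
  then show ?thesis
    using V_le_u[OF S] le_V[OF S times_from_trans[OF \<sigma> \<tau>(1)] times_from_trans[OF \<sigma> \<tau>(2)]]
    by eventually_elim (simp add: order_antisym)
qed

end

theorem proposition2:
  fixes M :: "'a measure" and F :: "real \<Rightarrow> 'a measure" and T :: real
    and \<theta> :: "nat \<Rightarrow> 'a \<Rightarrow> real" and p :: ennreal
    and \<rho> :: "('a \<Rightarrow> real) \<Rightarrow> ('a \<Rightarrow> real) \<Rightarrow> ('a \<Rightarrow> real) \<Rightarrow> ('a \<Rightarrow> real)"
    and \<psi> :: "('a \<Rightarrow> real) \<Rightarrow> ('a \<Rightarrow> real) \<Rightarrow> 'a \<Rightarrow> real"
    and \<Theta> :: "('a \<Rightarrow> real) set"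
    and S \<theta>opt \<theta>1 \<theta>2 \<tau>1 \<tau>2 :: "'a \<Rightarrow> real" and B :: "'a set"
  assumes operators: "bermudan_operators M F T \<theta> p \<rho>"
    and \<Theta>: "\<Theta> = bermudan_times M F T \<theta>"
    and \<psi>_admissible: "bi_admissible M F \<Theta> \<psi>"
    and \<psi>_integrable: "bi_p_integrable M p \<Theta> \<psi>"
    and V_finite: "\<forall>R\<in>\<Theta>. AE \<omega> in M. \<bar>value_V M \<Theta> \<rho> \<psi> R \<omega>\<bar> \<noteq> \<infinity>"
    and V_Lp: "\<forall>R\<in>\<Theta>. (\<lambda>\<omega>. real_of_ereal (value_V M \<Theta> \<rho> \<psi> R \<omega>)) \<in> Lp p M M"
    and S: "S \<in> \<Theta>"
    and \<theta>opt: "\<theta>opt \<in> times_from M \<Theta> S"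
    and \<theta>opt_optimal: "AE \<omega> in M. value_u M \<Theta> \<rho> \<psi> S \<omega>
      = ereal (\<rho> S \<theta>opt (\<lambda>\<omega>. real_of_ereal (reward_phi M \<Theta> \<rho> \<psi> \<theta>opt \<omega>)) \<omega>)"
    and \<theta>2: "\<theta>2 \<in> times_from M \<Theta> \<theta>opt"
    and \<theta>2_optimal: "AE \<omega> in M. value_v2 M \<Theta> \<rho> \<psi> \<theta>opt \<omega> = ereal (\<rho> \<theta>opt \<theta>2 (\<psi> \<theta>opt \<theta>2) \<omega>)"
    and \<theta>1: "\<theta>1 \<in> times_from M \<Theta> \<theta>opt"
    and \<theta>1_optimal: "AE \<omega> in M. value_v1 M \<Theta> \<rho> \<psi> \<theta>opt \<omega> = ereal (\<rho> \<theta>opt \<theta>1 (\<psi> \<theta>1 \<theta>opt) \<omega>)"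
    and B: "B = {\<omega> \<in> space M. value_v1 M \<Theta> \<rho> \<psi> \<theta>opt \<omega> \<le> value_v2 M \<Theta> \<rho> \<psi> \<theta>opt \<omega>}"
    and \<tau>1: "\<tau>1 = (\<lambda>\<omega>. \<theta>opt \<omega> * indicator B \<omega> + \<theta>1 \<omega> * indicator (space M - B) \<omega>)"
    and \<tau>2: "\<tau>2 = (\<lambda>\<omega>. \<theta>2 \<omega> * indicator B \<omega> + \<theta>opt \<omega> * indicator (space M - B) \<omega>)"
  shows "\<tau>1 \<in> times_from M \<Theta> S \<and> \<tau>2 \<in> times_from M \<Theta> S \<and>
    (AE \<omega> in M. value_V M \<Theta> \<rho> \<psi> S \<omega> = ereal (\<rho> S (rv_max \<tau>1 \<tau>2) (\<psi> \<tau>1 \<tau>2) \<omega>))"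
proof -
  interpret bermudan_operators M F T \<theta> p \<rho>
    by (rule operators)
  interpret double_stopping M F T \<theta> p \<rho> \<psi>
    by unfold_locales (use \<psi>_admissible \<psi>_integrable V_finite V_Lp in \<open>simp_all only: \<Theta>\<close>)
  have \<theta>opt_in: "\<theta>opt \<in> bermudan_times M F T \<theta>"
    using \<theta>opt unfolding \<Theta> times_from_def by blast
  note pair = pasted_pair_value[OF \<theta>opt_in \<theta>1[unfolded \<Theta>] \<theta>2[unfolded \<Theta>]
      \<theta>1_optimal[unfolded \<Theta>] \<theta>2_optimal[unfolded \<Theta>] B[unfolded \<Theta>] \<tau>1 \<tau>2]
  have "AE \<omega> in M. V S \<omega> = ereal (\<rho> S (rv_max \<tau>1 \<tau>2) (\<psi> \<tau>1 \<tau>2) \<omega>)"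
    by (rule pasted_pair_optimal[OF S[unfolded \<Theta>] \<theta>opt[unfolded \<Theta>] \<theta>opt_optimal[unfolded \<Theta>] pair])
  then show ?thesis
    unfolding \<Theta> using times_from_trans[OF \<theta>opt[unfolded \<Theta>]] pair(1,2) by blast
qed

end
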